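(* For every $n\geq1$, $\mathrm{NID}\notin\Sigma_n$ and $\mathrm{NID}\notin\Pi_n$. Equivalently, for every computable $f:\{0,1\}^*\times\{0,1\}^*\times\omega\to\mathbb{Q}$ with $\lim_{s\to\infty}f(x,y,s)=\mathrm{NID}(x,y)$ for all $x,y$, the number of oscillations (changes between nondecreasing and nonincreasing phases) of $s\mapsto f(x,y,s)$ is not bounded by any constant uniformly in $(x,y)$.
   Context: Fix a universal prefix-free machine $U$. $K$ denotes prefix-free Kolmogorov complexity and $K(x\mid y)$ conditional prefix-free complexity. For binary strings $x,y$ let $E(x,y)=\max\{K(x\mid y),K(y\mid x)\}$ and $\mathrm{NID}(x,y)=\dfrac{E(x,y)}{\max\{K(x),K(y)\}}$, a rational-valued limit-computable function. The oscillation classes: an approximation of $F$ is a computable $f$ with $\lim_{s\to\infty}f(z,s)=F(z)$ for all $z$; $F\in\Sigma_1$ if it has an approximation nondecreasing in $s$; $F\in\Pi_1$ if it has one nonincreasing in $s$; $F\in\Sigma_{n+1}$ if it has a computable approximation $f$ such that for every $z$ there is $s_z$ with $f(z,t)$ nondecreasing for $t<s_z$ and $(f(z,t))_{t\geq s_z}$ a $\Pi_n$-approximation; $F\in\Pi_{n+1}$ likewise with nonincreasing for $t<s_z$ and $(f(z,t))_{t\geq s_z}$ a $\Sigma_n$-approximation. *)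

theory Defs
  imports Complex_Main "HOL-Library.Sublist" "HOL-Library.Nat_Bijection"
begin

datatype recf = Zr | Sc | Proj nat | Comp recf "recf list" | Prim recf recf | Mn recf

inductive eval :: "recf \<Rightarrow> nat list \<Rightarrow> nat \<Rightarrow> bool" where
  ev_Z: "eval Zr xs 0"
| ev_S: "eval Sc xs (Suc (if xs = [] then 0 else hd xs))"
| ev_Proj: "eval (Proj i) xs (if i < length xs then xs ! i else 0)"
| ev_Comp: "length rs = length gs \<Longrightarrow> (\<forall>i<length gs. eval (gs ! i) xs (rs ! i))
             \<Longrightarrow> eval f rs r \<Longrightarrow> eval (Comp f gs) xs r"
| ev_Prim0: "eval f xs r \<Longrightarrow> eval (Prim f g) (0 # xs) r"
| ev_PrimS: "eval (Prim f g) (n # xs) r' \<Longrightarrow> eval g (r' # n # xs) r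
             \<Longrightarrow> eval (Prim f g) (Suc n # xs) r"
| ev_PrimNil: "eval f [] r \<Longrightarrow> eval (Prim f g) [] r"
| ev_Mn: "eval f (n # xs) 0 \<Longrightarrow> (\<forall>m<n. \<exists>k. k > 0 \<and> eval f (m # xs) k)
             \<Longrightarrow> eval (Mn f) xs n"

text \<open>Bijective encoding of binary strings (lists of bools) as natural numbers.\<close>
fun bl_enc :: "bool list \<Rightarrow> nat" where
  "bl_enc [] = 0"
| "bl_enc (b # bs) = 2 * bl_enc bs + (if b then 2 else 1)"

definition rat_enc :: "rat \<Rightarrow> nat" where
  "rat_enc q = prod_encode (int_encode (fst (quotient_of q)), int_encode (snd (quotient_of q)))"

text \<open>A (conditional) machine maps a program p and a condition y to an optional output.\<close>
type_synonym machine = "bool list \<Rightarrow> bool list \<Rightarrow> bool list option"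

definition partial_computable_machine :: "machine \<Rightarrow> bool" where
  "partial_computable_machine M \<longleftrightarrow>
     (\<exists>c. \<forall>p y r. eval c [bl_enc p, bl_enc y] r \<longleftrightarrow> (\<exists>z. M p y = Some z \<and> r = bl_enc z))"

definition prefix_free_machine :: "machine \<Rightarrow> bool" where
  "prefix_free_machine M \<longleftrightarrow>
     partial_computable_machine M \<and>
     (\<forall>y p q. M p y \<noteq> None \<longrightarrow> M q y \<noteq> None \<longrightarrow> prefix p q \<longrightarrow> p = q)"

text \<open>Universality in the sense of additive optimality among prefix-free machines.\<close>
definition universal_pf_machine :: "machine \<Rightarrow> bool" where
  "universal_pf_machine U \<longleftrightarrow> prefix_free_machine U \<and>
     (\<forall>M. prefix_free_machine M \<longrightarrow>
        (\<exists>c::nat. \<forall>p x y. M p y = Some x \<longrightarrow> (\<exists>q. U q y = Some x \<and> length q \<le> length p + c)))"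

definition Kc :: "machine \<Rightarrow> bool list \<Rightarrow> bool list \<Rightarrow> nat" where
  "Kc U x y = (LEAST n. \<exists>p. length p = n \<and> U p y = Some x)"

definition Kp :: "machine \<Rightarrow> bool list \<Rightarrow> nat" where
  "Kp U x = Kc U x []"

definition NID :: "machine \<Rightarrow> bool list \<Rightarrow> bool list \<Rightarrow> rat" where
  "NID U x y = of_nat (max (Kc U x y) (Kc U y x)) / of_nat (max (Kp U x) (Kp U y))"

fun sig_shape :: "nat \<Rightarrow> (nat \<Rightarrow> rat) \<Rightarrow> bool"
and pi_shape :: "nat \<Rightarrow> (nat \<Rightarrow> rat) \<Rightarrow> bool" where
  "sig_shape 0 g = False"
| "sig_shape (Suc 0) g = mono g"
| "sig_shape (Suc (Suc n)) g =
     (\<exists>s0. mono_on {..<s0} g \<and> pi_shape (Suc n) (\<lambda>t. g (t + s0)))"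
| "pi_shape 0 g = False"
| "pi_shape (Suc 0) g = antimono g"
| "pi_shape (Suc (Suc n)) g =
     (\<exists>s0. antimono_on {..<s0} g \<and> sig_shape (Suc n) (\<lambda>t. g (t + s0)))"

definition computable_approx :: "(bool list \<Rightarrow> bool list \<Rightarrow> nat \<Rightarrow> rat) \<Rightarrow> bool" where
  "computable_approx f \<longleftrightarrow>
     (\<exists>c. \<forall>x y s r. eval c [bl_enc x, bl_enc y, s] r \<longleftrightarrow> r = rat_enc (f x y s))"

definition approximates :: "(bool list \<Rightarrow> bool list \<Rightarrow> nat \<Rightarrow> rat) \<Rightarrow> (bool list \<Rightarrow> bool list \<Rightarrow> rat) \<Rightarrow> bool" where
  "approximates f F \<longleftrightarrow> computable_approx f \<and>
     (\<forall>x y. (\<lambda>s. real_of_rat (f x y s)) \<longlonglongrightarrow> real_of_rat (F x y))"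

definition in_Sigma :: "nat \<Rightarrow> (bool list \<Rightarrow> bool list \<Rightarrow> rat) \<Rightarrow> bool" where
  "in_Sigma n F \<longleftrightarrow> (\<exists>f. approximates f F \<and> (\<forall>x y. sig_shape n (f x y)))"

definition in_Pi :: "nat \<Rightarrow> (bool list \<Rightarrow> bool list \<Rightarrow> rat) \<Rightarrow> bool" where
  "in_Pi n F \<longleftrightarrow> (\<exists>f. approximates f F \<and> (\<forall>x y. pi_shape n (f x y)))"

end

theory Submission
  imports Defs
begin

text \<open>Let \<open>f\<close> be a computable approximation of NID. In a product \<open>A \<times> B\<close> of two computable sets of
  \<open>2\<^sup>M\<close> strings most pairs are independent, so their NID is close to 1 and \<open>f\<close> must exceed \<open>2/3\<close>. Once
  this has been observed, split \<open>A\<close> and \<open>B\<close> into blocks of size \<open>2\<^sup>M\<^sup>/\<^sup>8\<close> and computably search for a matching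
  of the blocks of \<open>A\<close> with those of \<open>B\<close> such that it has been observed for most pairs lying in matched
  blocks. For such pairs each component determines the block of the other one, hence the information
  distance drops to about \<open>M/8\<close> while most components still have complexity about \<open>M\<close>, and \<open>f\<close> must fall
  below \<open>1/3\<close>. Once this has been observed, computably search for one pair of matched blocks most of whose
  pairs have gone through this oscillation. It is again a product of computable sets, of size
  \<open>2\<^sup>M\<^sup>/\<^sup>8\<close>, and the argument repeats. Lower bounds on complexity come from counting programs, upper bounds from
  universality.\<close>

section \<open>Total computable functions\<close>

text \<open>The argument is an assignment to de Bruijn variables, of which only finitely many may be used;
  keeping that number existential hides arities from the closure rules.\<close>

definition comput :: "((nat \<Rightarrow> nat) \<Rightarrow> nat) \<Rightarrow> bool" where
  "comput F \<longleftrightarrow> (\<exists>n c. \<forall>e r. eval c (map e [0..<n]) r \<longleftrightarrow> r = F e)"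

section \<open>Evaluation of total codes\<close>

inductive_cases eval_ProjE: "eval (Proj i) xs r"
inductive_cases eval_CompE: "eval (Comp f gs) xs r"
inductive_cases eval_Prim0E: "eval (Prim f g) (0 # xs) r"
inductive_cases eval_PrimSE: "eval (Prim f g) (Suc n # xs) r"
inductive_cases eval_MnE: "eval (Mn f) xs r"
inductive_cases eval_ZrE: "eval Zr xs r"
inductive_cases eval_ScE: "eval Sc xs r"

lemma eval_Proj_iff: "eval (Proj i) xs r \<longleftrightarrow> r = (if i < length xs then xs ! i else 0)"
  using ev_Proj[of i xs] by (auto elim: eval_ProjE)

lemma eval_Zr_iff: "eval Zr xs r \<longleftrightarrow> r = 0"
  by (auto elim: eval_ZrE intro: ev_Z)

lemma eval_Sc_iff: "eval Sc (x # xs) r \<longleftrightarrow> r = Suc x"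
  using ev_S[of "x # xs"] by (auto elim: eval_ScE)

lemma eval_Comp_iff:
  "eval (Comp f gs) xs r \<longleftrightarrow>
     (\<exists>rs. length rs = length gs \<and> (\<forall>i<length gs. eval (gs ! i) xs (rs ! i)) \<and> eval f rs r)"
  by (auto elim!: eval_CompE intro: ev_Comp)

text \<open>An equivalence carries existence and uniqueness of the value together, so determinism of
  \<open>eval\<close> passes from the components to the composite.\<close>

lemma eval_Comp_total:
  assumes "\<And>i r. i < length gs \<Longrightarrow> eval (gs ! i) xs r \<longleftrightarrow> r = R i"
  shows "eval (Comp f gs) xs r \<longleftrightarrow> eval f (map R [0..<length gs]) r"
proof
  assume "eval (Comp f gs) xs r"
  then obtain rs where rs: "length rs = length gs" "\<forall>i<length gs. eval (gs ! i) xs (rs ! i)"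
    "eval f rs r"
    by (auto simp: eval_Comp_iff)
  have "rs = map R [0..<length gs]"
    using rs assms by (intro nth_equalityI) auto
  with rs show "eval f (map R [0..<length gs]) r" by simp
next
  assume "eval f (map R [0..<length gs]) r"
  then show "eval (Comp f gs) xs r"
    unfolding eval_Comp_iff by (intro exI[of _ "map R [0..<length gs]"]) (auto simp: assms)
qed

lemma eval_Prim_total:
  assumes "\<And>r. eval f xs r \<longleftrightarrow> r = F"
    and "\<And>i r' r. eval g (r' # i # xs) r \<longleftrightarrow> r = G i r'"
  shows "eval (Prim f g) (n # xs) r \<longleftrightarrow> r = rec_nat F G n"
proof (induction n arbitrary: r)
  case 0
  show ?case using assms(1) by (auto elim: eval_Prim0E intro: ev_Prim0)
next
  case (Suc n)
  show ?case
    using Suc assms(2) by (auto elim!: eval_PrimSE intro!: ev_PrimS)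
qed

lemma eval_Mn_total:
  assumes "\<And>n r. eval f (n # xs) r \<longleftrightarrow> r = F n"
  shows "eval (Mn f) xs n \<longleftrightarrow> F n = 0 \<and> (\<forall>m<n. F m \<noteq> 0)"
proof
  assume "eval (Mn f) xs n"
  then show "F n = 0 \<and> (\<forall>m<n. F m \<noteq> 0)"
    by (elim eval_MnE) (use assms in force)
next
  assume "F n = 0 \<and> (\<forall>m<n. F m \<noteq> 0)"
  then show "eval (Mn f) xs n"
    by (intro ev_Mn) (auto simp: assms)
qed

text \<open>Composing with projections makes a code ignore further arguments, so finitely many codes
  can be given one common arity.\<close>

lemma comput_code:
  assumes "comput F"
  obtains n where "\<And>m. m \<ge> n \<Longrightarrow> \<exists>c. \<forall>e r. eval c (map e [0..<m]) r \<longleftrightarrow> r = F e"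
proof -
  from assms obtain n c where c: "\<And>e r. eval c (map e [0..<n]) r \<longleftrightarrow> r = F e"
    by (auto simp: comput_def)
  have "\<exists>c. \<forall>e r. eval c (map e [0..<m]) r \<longleftrightarrow> r = F e" if "m \<ge> n" for m
  proof (intro exI[of _ "Comp c (map Proj [0..<n])"] allI)
    fix e r
    have "eval (Comp c (map Proj [0..<n])) (map e [0..<m]) r \<longleftrightarrow>
        eval c (map e [0..<length (map Proj [0..<n])]) r"
      using that by (intro eval_Comp_total) (auto simp: eval_Proj_iff)
    then show "eval (Comp c (map Proj [0..<n])) (map e [0..<m]) r \<longleftrightarrow> r = F e"
      by (simp add: c)
  qed
  then show thesis using that by blast
qed

named_theorems comput_intros

lemma comput_var [comput_intros]: "comput (\<lambda>e. e i)"
  unfolding comput_def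
  by (intro exI[of _ "Suc i"] exI[of _ "Proj i"]) (auto simp: eval_Proj_iff simp del: upt_Suc)

lemma comput_subst:
  assumes "comput F" and "\<And>i. comput (G i)"
  shows "comput (\<lambda>e. F (\<lambda>i. G i e))"
proof -
  from assms(1) obtain n c where c: "\<And>e r. eval c (map e [0..<n]) r \<longleftrightarrow> r = F e"
    by (auto simp: comput_def)
  have "\<exists>k. \<forall>m\<ge>k. \<exists>d. \<forall>e r. eval d (map e [0..<m]) r \<longleftrightarrow> r = G i e" for i
    using comput_code[OF assms(2)[of i]] by metis
  then obtain k where k: "\<And>i m. m \<ge> k i \<Longrightarrow> \<exists>d. \<forall>e r. eval d (map e [0..<m]) r \<longleftrightarrow> r = G i e"
    by metis
  \<comment> \<open>The sum is a common upper bound for the arities of the finitely many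
    \<open>G i\<close> that \<open>c\<close> reads.\<close>
  define m where "m = sum k {..<n}"
  have "m \<ge> k i" if "i < n" for i
    unfolding m_def using that by (intro member_le_sum) auto
  then have "\<forall>i\<in>{..<n}. \<exists>d. \<forall>e r. eval d (map e [0..<m]) r \<longleftrightarrow> r = G i e"
    using k by simp
  then obtain d where d: "\<And>i e r. i < n \<Longrightarrow> eval (d i) (map e [0..<m]) r \<longleftrightarrow> r = G i e"
    by (metis lessThan_iff)
  have "eval (Comp c (map d [0..<n])) (map e [0..<m]) r \<longleftrightarrow> r = F (\<lambda>i. G i e)" for e r
  proof -
    have "eval (Comp c (map d [0..<n])) (map e [0..<m]) r \<longleftrightarrow>
        eval c (map (\<lambda>i. G i e) [0..<length (map d [0..<n])]) r"
      by (intro eval_Comp_total) (auto simp: d)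
    then show ?thesis by (simp add: c)
  qed
  then show ?thesis unfolding comput_def by blast
qed

lemma comput_subst1:
  assumes "comput (\<lambda>e. F (e 0))" "comput A"
  shows "comput (\<lambda>e. F (A e))"
  using comput_subst[OF assms(1), of "\<lambda>i. A"] assms(2) by simp

lemma comput_subst3:
  assumes "comput (\<lambda>e. F (e 0) (e 1) (e 2))" "comput A" "comput B" "comput C"
  shows "comput (\<lambda>e. F (A e) (B e) (C e))"
  using comput_subst[OF assms(1), of "\<lambda>i. if i = 0 then A else if i = 1 then B else C"] assms(2-)
  by (simp split: if_splits)

lemma comput_subst4:
  assumes "comput (\<lambda>e. F (e 0) (e 1) (e 2) (e 3))" "comput A" "comput B" "comput C" "comput D"
  shows "comput (\<lambda>e. F (A e) (B e) (C e) (D e))"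
  using comput_subst[OF assms(1),
      of "\<lambda>i. if i = 0 then A else if i = 1 then B else if i = 2 then C else D"] assms(2-)
  by (simp split: if_splits)

lemma comput_Suc [comput_intros]:
  assumes "comput F"
  shows "comput (\<lambda>e. Suc (F e))"
proof (rule comput_subst1[OF _ assms])
  have "eval Sc (map e [0..<1]) r \<longleftrightarrow> r = Suc (e 0)" for e :: "nat \<Rightarrow> nat" and r
    by (simp add: eval_Sc_iff)
  then show "comput (\<lambda>e. Suc (e 0))"
    unfolding comput_def by blast
qed

lemma comput_const [comput_intros]: "comput (\<lambda>e. k)"
proof (induction k)
  case 0
  show ?case unfolding comput_def by (intro exI[of _ 0] exI[of _ Zr]) (simp add: eval_Zr_iff)
qed (rule comput_Suc)

text \<open>In the hypothesis on \<open>G\<close>, variable 0 is the previous value, variable 1 the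
  counter, and the environment is shifted by two, as in the argument order of
  \<open>ev_PrimS\<close>.\<close>

lemma comput_rec:
  assumes "comput B" and "comput F" and G: "comput (\<lambda>e. G (e 0) (e 1) (\<lambda>i. e (i + 2)))"
  shows "comput (\<lambda>e. rec_nat (F e) (\<lambda>i r. G r i e) (B e))"
proof -
  obtain n1 where n1: "\<And>m. m \<ge> n1 \<Longrightarrow> \<exists>c. \<forall>e r. eval c (map e [0..<m]) r \<longleftrightarrow> r = F e"
    using comput_code[OF assms(2)] by blast
  obtain n2 where n2: "\<And>m. m \<ge> n2 \<Longrightarrow>
      \<exists>c. \<forall>e r. eval c (map e [0..<m]) r \<longleftrightarrow> r = G (e 0) (e 1) (\<lambda>i. e (i + 2))"
    using comput_code[OF G] by blast
  define n where "n = max n1 n2"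
  obtain c where c: "\<And>e r. eval c (map e [0..<n]) r \<longleftrightarrow> r = F e"
    using n1[of n] by (auto simp: n_def)
  obtain d where d: "\<And>e r. eval d (map e [0..<n + 2]) r \<longleftrightarrow> r = G (e 0) (e 1) (\<lambda>i. e (i + 2))"
    using n2[of "n + 2"] unfolding n_def by (meson max.cobounded2 trans_le_add1)
  have d': "eval d (r' # i # map e [0..<n]) r \<longleftrightarrow> r = G r' i e" for r' i e r
  proof -
    have "map (case_nat r' (case_nat i e)) [0..<n + 2] = r' # i # map e [0..<n]"
      by (simp add: upt_conv_Cons map_Suc_upt[symmetric] comp_def del: upt_Suc)
    with d[of "case_nat r' (case_nat i e)" r] show ?thesis by simp
  qed
  have "comput (\<lambda>e. rec_nat (F (\<lambda>i. e (Suc i))) (\<lambda>i r. G r i (\<lambda>i. e (Suc i))) (e 0))"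
    unfolding comput_def
  proof (intro exI[of _ "Suc n"] exI[of _ "Prim c d"] allI)
    fix e :: "nat \<Rightarrow> nat" and r
    have "map e [0..<Suc n] = e 0 # map (\<lambda>i. e (Suc i)) [0..<n]"
      by (simp add: upt_conv_Cons map_Suc_upt[symmetric] comp_def del: upt_Suc)
    then show "eval (Prim c d) (map e [0..<Suc n]) r \<longleftrightarrow>
        r = rec_nat (F (\<lambda>i. e (Suc i))) (\<lambda>i r. G r i (\<lambda>i. e (Suc i))) (e 0)"
      by (simp only:) (rule eval_Prim_total; simp add: c d')
  qed
  \<comment> \<open>So far the recursion runs up to variable 0; putting \<open>B e\<close> in front
    of the environment gives the general bound.\<close>
  note reindexed = comput_subst[OF this, of "\<lambda>i e. case_nat (B e) e i"]
  show ?thesis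
  proof -
    have "comput (\<lambda>e. case i of 0 \<Rightarrow> B e | Suc j \<Rightarrow> e j)" for i
      by (cases i) (simp_all add: assms(1) comput_var)
    then show ?thesis by (rule reindexed[simplified])
  qed
qed

section \<open>Arithmetic, Boolean and bounded operations\<close>

lemma comput_add [comput_intros]:
  assumes "comput A" "comput B"
  shows "comput (\<lambda>e. A e + B e)"
proof -
  have "comput (\<lambda>e. rec_nat (A e) (\<lambda>i r. Suc r) (B e))"
    by (intro comput_rec assms comput_intros)
  moreover have "rec_nat a (\<lambda>i r. Suc r) b = a + b" for a b by (induction b) auto
  ultimately show ?thesis by simp
qed

lemma comput_sum [comput_intros]:
  assumes "comput B" and G: "comput (\<lambda>e. G (e 0) (\<lambda>i. e (Suc i)))"
  shows "comput (\<lambda>e. \<Sum>i<B e. G i e)"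
proof -
  have "comput (\<lambda>e. G (e 1) (\<lambda>i. e (i + 2)))"
    using comput_subst[OF G, of "\<lambda>i e. e (Suc i)"] by (simp add: comput_var)
  then have "comput (\<lambda>e. rec_nat 0 (\<lambda>i r. r + G i e) (B e))"
    by (intro comput_rec assms comput_intros)
  moreover have "rec_nat 0 (\<lambda>i r. r + g i) b = (\<Sum>i<b. g i)" for g :: "nat \<Rightarrow> nat" and b
    by (induction b) auto
  ultimately show ?thesis by simp
qed

lemma comput_mult [comput_intros]:
  assumes "comput A" "comput B"
  shows "comput (\<lambda>e. A e * B e)"
proof -
  have "comput (\<lambda>e. rec_nat 0 (\<lambda>i r. r + A e) (B e))"
    using comput_subst[OF assms(1), of "\<lambda>i e. e (i + 2)"]
    by (intro comput_rec assms comput_intros) (simp add: comput_var)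
  moreover have "rec_nat 0 (\<lambda>i r. r + a) b = a * b" for a b :: nat by (induction b) auto
  ultimately show ?thesis by simp
qed

lemma comput_power [comput_intros]:
  assumes "comput A" "comput B"
  shows "comput (\<lambda>e. A e ^ B e)"
proof -
  have "comput (\<lambda>e. rec_nat 1 (\<lambda>i r. r * A e) (B e))"
    using comput_subst[OF assms(1), of "\<lambda>i e. e (i + 2)"]
    by (intro comput_rec assms comput_intros) (simp add: comput_var)
  moreover have "rec_nat 1 (\<lambda>i r. r * a) b = a ^ b" for a b :: nat by (induction b) auto
  ultimately show ?thesis by simp
qed

lemma comput_diff [comput_intros]:
  assumes "comput A" "comput B"
  shows "comput (\<lambda>e. A e - B e)"
proof -
  have "comput (\<lambda>e. rec_nat 0 (\<lambda>i r. i) (A e))" if "comput A" for A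
    by (intro comput_rec that comput_intros)
  moreover have "rec_nat 0 (\<lambda>i r. i) a = a - 1" for a by (cases a) auto
  ultimately have "comput (\<lambda>e. A e - 1)" if "comput A" for A
    using that by simp
  note pred = this
  have "comput (\<lambda>e. rec_nat (A e) (\<lambda>i r. r - 1) (B e))"
    by (intro comput_rec assms pred comput_var)
  moreover have "rec_nat a (\<lambda>i r. r - 1) b = a - b" for a b :: nat by (induction b) auto
  ultimately show ?thesis by simp
qed

lemma comput_not [comput_intros]:
  assumes "comput (\<lambda>e. of_bool (P e))"
  shows "comput (\<lambda>e. of_bool (\<not> P e))"
proof -
  have "comput (\<lambda>e. 1 - of_bool (P e))"
    by (intro comput_intros assms)
  moreover have "1 - of_bool p = (of_bool (\<not> p) :: nat)" for p by auto
  ultimately show ?thesis by simp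
qed

lemma comput_conj [comput_intros]:
  assumes "comput (\<lambda>e. of_bool (P e))" "comput (\<lambda>e. of_bool (Q e))"
  shows "comput (\<lambda>e. of_bool (P e \<and> Q e))"
  using comput_mult[OF assms] by (simp add: of_bool_conj)

lemma comput_disj [comput_intros]:
  assumes "comput (\<lambda>e. of_bool (P e))" "comput (\<lambda>e. of_bool (Q e))"
  shows "comput (\<lambda>e. of_bool (P e \<or> Q e))"
proof -
  have "comput (\<lambda>e. of_bool (\<not> (\<not> P e \<and> \<not> Q e)))"
    by (intro comput_intros assms)
  then show ?thesis by simp
qed

lemma comput_less [comput_intros]:
  assumes "comput A" "comput B"
  shows "comput (\<lambda>e. of_bool (A e < B e))"
proof -
  have "comput (\<lambda>e. 1 - (1 - (B e - A e)))"
    by (intro comput_intros assms)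
  moreover have "1 - (1 - (b - a)) = (of_bool (a < b) :: nat)" for a b :: nat by auto
  ultimately show ?thesis by simp
qed

lemma comput_le [comput_intros]:
  assumes "comput A" "comput B"
  shows "comput (\<lambda>e. of_bool (A e \<le> B e))"
  using comput_not[OF comput_less[OF assms(2,1)]] by (simp add: not_less)

lemma comput_eq [comput_intros]:
  assumes "comput A" "comput B"
  shows "comput (\<lambda>e. of_bool (A e = B e))"
  using comput_conj[OF comput_le[OF assms] comput_le[OF assms(2,1)]] by (simp add: eq_iff)

lemma comput_bex [comput_intros]:
  assumes "comput B" and "comput (\<lambda>e. of_bool (P (e 0) (\<lambda>i. e (Suc i))))"
  shows "comput (\<lambda>e. of_bool (\<exists>i\<le>B e. P i e))"
proof -
  have "comput (\<lambda>e. of_bool ((0::nat) < (\<Sum>i<Suc (B e). of_bool (P i e))))"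
    by (intro comput_intros assms)
  moreover have "0 < (\<Sum>i<Suc b. of_bool (p i) :: nat) \<longleftrightarrow> (\<exists>i\<le>b. p i)" for p and b
    by (auto simp: zero_less_iff_neq_zero less_Suc_eq_le simp del: sum.lessThan_Suc)
  ultimately show ?thesis by (simp only:)
qed

lemma comput_div [comput_intros]:
  assumes "comput A" "comput B" "\<And>e. B e > 0"
  shows "comput (\<lambda>e. A e div B e)"
proof -
  \<comment> \<open>The quotient counts the \<open>k\<close> with \<open>Suc k * B e <= A e\<close>;
    all of them are below \<open>A e\<close> because \<open>B e\<close> is positive.\<close>
  have "comput (\<lambda>e. \<Sum>k<A e. of_bool (Suc k * B e \<le> A e))"
    using comput_subst[OF assms(1), of "\<lambda>i e. e (Suc i)"]
      comput_subst[OF assms(2), of "\<lambda>i e. e (Suc i)"]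
    by (intro comput_intros assms(1)) (simp_all add: comput_var)
  moreover have "(\<Sum>k<a. of_bool (Suc k * b \<le> a)) = a div b" if "b > 0" for a b :: nat
  proof -
    have "{k \<in> {..<a}. Suc k * b \<le> a} = {..<a div b}"
      using that less_le_trans[OF _ div_le_dividend[of a b]]
      by (auto simp: less_eq_div_iff_mult_less_eq Suc_le_eq[symmetric] simp del: mult_Suc)
    then have "card {k \<in> {..<a}. Suc k * b \<le> a} = a div b" by simp
    moreover have "(\<Sum>k<a. of_bool (Suc k * b \<le> a)) = card {k \<in> {..<a}. Suc k * b \<le> a}"
      by (subst sum_of_bool_eq) (auto simp: Int_def)
    ultimately show ?thesis by simp
  qed
  ultimately show ?thesis using assms(3) by simp
qed

lemma comput_mod [comput_intros]:
  assumes "comput A" "comput B" "\<And>e. B e > 0"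
  shows "comput (\<lambda>e. A e mod B e)"
  using comput_diff[OF assms(1) comput_mult[OF comput_div[OF assms] assms(2)]]
  by (simp add: minus_div_mult_eq_mod)

section \<open>Unbounded search\<close>

lemma comput_Least:
  assumes P: "comput (\<lambda>e. of_bool (P (e 0) (\<lambda>i. e (Suc i))))" and ex: "\<And>e. \<exists>n. P n e"
  shows "comput (\<lambda>e. LEAST n. P n e)"
proof -
  \<comment> \<open>\<open>Mn\<close> looks for a zero, so the predicate enters negated.\<close>
  obtain n where "\<And>m. m \<ge> n \<Longrightarrow>
      \<exists>c. \<forall>e r. eval c (map e [0..<m]) r \<longleftrightarrow> r = of_bool (\<not> P (e 0) (\<lambda>i. e (Suc i)))"
    using comput_code[OF comput_not[OF P]] by blast
  then obtain c where c: "\<And>e r. eval c (map e [0..<Suc n]) r \<longleftrightarrow>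
      r = of_bool (\<not> P (e 0) (\<lambda>i. e (Suc i)))"
    by (meson le_SucI order_refl)
  have "eval (Mn c) (map e [0..<n]) r \<longleftrightarrow> r = (LEAST n. P n e)" for e r
  proof -
    have "eval c (k # map e [0..<n]) r \<longleftrightarrow> r = of_bool (\<not> P k e)" for k r
    proof -
      have "map (case_nat k e) [0..<Suc n] = k # map e [0..<n]"
        by (simp add: upt_conv_Cons map_Suc_upt[symmetric] comp_def del: upt_Suc)
      with c[of "case_nat k e" r] show ?thesis by simp
    qed
    then have "eval (Mn c) (map e [0..<n]) r \<longleftrightarrow> P r e \<and> (\<forall>m<r. \<not> P m e)"
      using eval_Mn_total[where F = "\<lambda>k. of_bool (\<not> P k e)"] by simp
    also have "\<dots> \<longleftrightarrow> r = (LEAST n. P n e)"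
      using ex[of e] by (metis LeastI_ex Least_equality not_less not_less_Least)
    finally show ?thesis .
  qed
  then show ?thesis unfolding comput_def by blast
qed

text \<open>Whether some \<open>s\<close> works for a given \<open>j\<close> is only semidecidable.
  Hence \<open>j\<close> and \<open>s\<close> are searched jointly: first a bound on both, then the
  least \<open>j\<close> with a witness below that bound.\<close>

lemma comput_select:
  assumes Q: "comput (\<lambda>e. of_bool (Q (e 0) (e 1) (e 2)))" and ex: "\<And>m. \<exists>j s. Q m j s"
  shows "\<exists>J. comput (\<lambda>e. J (e 0)) \<and> (\<forall>m. \<exists>s. Q m (J m) s)"
proof -
  define S where "S m = (LEAST n. \<exists>j\<le>n. \<exists>s\<le>n. Q m j s)" for m
  define J where "J m = (LEAST j. \<exists>s\<le>S m. Q m j s)" for m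
  have Q': "comput (\<lambda>e. of_bool (Q (A e) (B e) (C e)))"
    if "comput A" "comput B" "comput C" for A B C
    using comput_subst3[where F = "\<lambda>x y z. of_bool (Q x y z)", OF Q that] .
  have ex1: "\<exists>n. \<exists>j\<le>n. \<exists>s\<le>n. Q m j s" for m
    using ex[of m] by (meson max.cobounded1 max.cobounded2)
  have S: "comput (\<lambda>e. S (e 0))"
    unfolding S_def by (intro comput_Least comput_intros Q' ex1)
  have ex2: "\<exists>j. \<exists>s\<le>S m. Q m j s" for m
    using LeastI_ex[OF ex1[of m]] unfolding S_def by blast
  have "comput (\<lambda>e. J (e 0))"
    unfolding J_def by (intro comput_Least comput_intros Q' ex2 comput_subst1[OF S])
  moreover have "\<exists>s. Q m (J m) s" for m
    using LeastI_ex[OF ex2[of m]] unfolding J_def by blast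
  ultimately show ?thesis by blast
qed


text \<open>Missing arguments read as 0, so the code has a known value on lists of every length,
  even shorter than its arity.\<close>

lemma comput_eval:
  assumes "comput F"
  obtains c where "\<And>xs r. eval c xs r \<longleftrightarrow> r = F (\<lambda>i. if i < length xs then xs ! i else 0)"
proof -
  from assms obtain n c where c: "\<And>e r. eval c (map e [0..<n]) r \<longleftrightarrow> r = F e"
    by (auto simp: comput_def)
  have "eval (Comp c (map Proj [0..<n])) xs r \<longleftrightarrow>
      eval c (map (\<lambda>i. if i < length xs then xs ! i else 0) [0..<length (map Proj [0..<n])]) r"
    for xs r
    by (intro eval_Comp_total) (auto simp: eval_Proj_iff)
  then show thesis using that[of "Comp c (map Proj [0..<n])"] by (simp add: c)
qed

section \<open>Strings as natural numbers\<close>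

definition str :: "nat \<Rightarrow> bool list" where
  "str = inv bl_enc"

lemma bl_enc_inj: "bl_enc p = bl_enc q \<Longrightarrow> p = q"
proof (induction p arbitrary: q)
  case Nil
  then show ?case by (cases q) (auto split: if_splits)
next
  case (Cons b p)
  obtain b' q' where q: "q = b' # q'"
    using Cons.prems by (cases q) (auto split: if_splits)
  have "b = b' \<and> bl_enc p = bl_enc q'"
    using Cons.prems unfolding q by (cases b; cases b'; simp; presburger)
  then show ?case using Cons.IH q by auto
qed

lemma bl_enc_surj: "\<exists>p. bl_enc p = n"
proof (induction n rule: less_induct)
  case (less n)
  consider "n = 0" | k where "n = 2 * k + 1" | k where "n = 2 * k + 2"
    by atomize_elim presburger
  then show ?case
  proof cases
    case 1
    then show ?thesis by (intro exI[of _ "[]"]) simp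
  next
    case (2 k)
    then obtain p where "bl_enc p = k" using less[of k] by auto
    then show ?thesis using 2 by (intro exI[of _ "False # p"]) simp
  next
    case (3 k)
    then obtain p where "bl_enc p = k" using less[of k] by auto
    then show ?thesis using 3 by (intro exI[of _ "True # p"]) simp
  qed
qed

lemma bl_enc_str [simp]: "bl_enc (str n) = n"
  unfolding str_def using bl_enc_surj by (intro f_inv_into_f) (auto simp: image_iff, metis)

lemma str_bl_enc [simp]: "str (bl_enc p) = p"
  by (intro bl_enc_inj) simp

lemma str_eq_iff [simp]: "str m = str n \<longleftrightarrow> m = n"
  by (metis bl_enc_str)

lemma str_0 [simp]: "str 0 = []"
  by (intro bl_enc_inj) simp

text \<open>In binary, \<open>bl_enc p + 1\<close> is a leading 1 above the bits of
  \<open>p\<close>, the first symbol of \<open>p\<close> being least significant. Lengths thus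
  become comparisons with powers of two.\<close>

lemma bl_enc_bounds: "2 ^ length p \<le> bl_enc p + 1 \<and> bl_enc p + 1 < 2 ^ Suc (length p)"
  by (induction p) auto

lemma length_eq_bl_enc: "length p = n \<longleftrightarrow> 2 ^ n \<le> bl_enc p + 1 \<and> bl_enc p + 1 < 2 ^ Suc n"
proof
  assume *: "2 ^ n \<le> bl_enc p + 1 \<and> bl_enc p + 1 < 2 ^ Suc n"
  then have "(2::nat) ^ n < 2 ^ Suc (length p)" "(2::nat) ^ length p < 2 ^ Suc n"
    using bl_enc_bounds[of p] by linarith+
  then have "n < Suc (length p)" "length p < Suc n"
    by (metis one_less_numeral_iff power_less_imp_less_exp semiring_norm(76))+
  then show "length p = n" by simp
qed (use bl_enc_bounds in auto)

lemma bl_enc_program: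
  "bl_enc (replicate m False @ True # u) + 1 = 2 ^ m * (2 * (bl_enc u + 1) + 1)"
  by (induction m) (auto simp: algebra_simps)

section \<open>Upper and lower bounds on complexity\<close>

text \<open>Programs have the form \<open>0\<^sup>m 1 u\<close> with \<open>|u| = l m\<close>. The unary code for \<open>m\<close> is affordable because
  all block lengths occurring below are at least \<open>8 m\<close>.\<close>

lemma universal_program:
  assumes U: "universal_pf_machine U"
    and l: "comput (\<lambda>e. l (e 0))" and h: "comput (\<lambda>e. h (e 0) (e 1) (e 2))"
  shows "\<exists>c. \<forall>m v y. v < 2 ^ l m \<longrightarrow>
    (\<exists>q. U q (str y) = Some (str (h m v y)) \<and> length q \<le> m + l m + c)"
proof -
  define lead where "lead p = length (takeWhile Not p)" for p
  define valid where "valid m p \<longleftrightarrow> m = lead p \<and> length p = Suc (m + l m)" for m p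
  \<comment> \<open>Dividing by \<open>2 ^ Suc m\<close> strips the low bits, which hold the zeros
    and the separator, and leaves \<open>bl_enc u + 1\<close>; for \<open>u\<close> of length
    \<open>l m\<close> this is \<open>2 ^ l m\<close> plus the index of \<open>u\<close>.\<close>
  define out where "out m P Y = h m ((P + 1) div 2 ^ Suc m - 2 ^ l m) Y" for m P Y
  define M :: machine where
    "M p y = (if valid (lead p) p then Some (str (out (lead p) (bl_enc p) (bl_enc y))) else None)" for p y
  \<comment> \<open>The arithmetic form of \<open>valid\<close> on codes, with \<open>w\<close> as
    the code of \<open>u\<close>; the bounded quantifier makes it decidable.\<close>
  define cond where "cond m P \<longleftrightarrow>
    (\<exists>w\<le>P. 2 ^ l m \<le> w + 1 \<and> w + 1 < 2 ^ Suc (l m) \<and> P + 1 = 2 ^ m * (2 * (w + 1) + 1))" for m P :: nat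
  note l' = comput_subst1[OF l] and h' = comput_subst3[OF h]
  have lead_program: "lead (replicate m False @ True # u) = m" for m u
    unfolding lead_def by (simp add: takeWhile_append)
  have valid_iff: "valid m p \<longleftrightarrow> (\<exists>u. length u = l m \<and> p = replicate m False @ True # u)" for m p
  proof
    assume v: "valid m p"
    then have len: "length (takeWhile Not p) = m" "m < length p"
      by (auto simp: valid_def lead_def)
    have "takeWhile Not p = replicate m False"
      using len(1) by (intro replicate_eqI) (auto dest: set_takeWhileD)
    moreover have "p ! m"
      using nth_length_takeWhile[of Not p] len by simp
    moreover have "p = take m p @ p ! m # drop (Suc m) p"
      using len(2) by (rule id_take_nth_drop)
    moreover have "take m p = takeWhile Not p"
      by (metis len(1) takeWhile_eq_take)
    ultimately have "p = replicate m False @ True # drop (Suc m) p" by simp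
    moreover have "length (drop (Suc m) p) = l m"
      using v by (simp add: valid_def)
    ultimately show "\<exists>u. length u = l m \<and> p = replicate m False @ True # u" by blast
  next
    assume "\<exists>u. length u = l m \<and> p = replicate m False @ True # u"
    then show "valid m p" by (auto simp: valid_def lead_program)
  qed
  have cond_iff: "cond m (bl_enc p) \<longleftrightarrow> valid m p" for m p
  proof
    assume "cond m (bl_enc p)"
    then obtain w where w: "2 ^ l m \<le> w + 1" "w + 1 < 2 ^ Suc (l m)"
      "bl_enc p + 1 = 2 ^ m * (2 * (w + 1) + 1)"
      by (auto simp: cond_def)
    then have "length (str w) = l m"
      by (subst length_eq_bl_enc) simp
    moreover have "p = replicate m False @ True # str w"
      by (rule bl_enc_inj) (use bl_enc_program[of m "str w"] w(3) in simp)
    ultimately show "valid m p" unfolding valid_iff by blast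
  next
    assume "valid m p"
    then obtain u where u: "length u = l m" "p = replicate m False @ True # u"
      by (auto simp: valid_iff)
    have eq: "bl_enc p + 1 = 2 ^ m * (2 * (bl_enc u + 1) + 1)"
      unfolding u(2) by (rule bl_enc_program)
    have "1 * (2 * (bl_enc u + 1) + 1) \<le> bl_enc p + 1"
      unfolding eq by (intro mult_right_mono) auto
    then have "bl_enc u \<le> bl_enc p" by simp
    then show "cond m (bl_enc p)"
      unfolding cond_def using u(1) eq length_eq_bl_enc[of u "l m"] by blast
  qed
  have "comput (\<lambda>e. of_bool (\<not> cond (e 0) (e 1)))"
    unfolding cond_def by (intro comput_intros l')
  from comput_eval[OF this] obtain C where
    C: "\<And>xs r. eval C xs r \<longleftrightarrow> r = of_bool (\<not> cond ((\<lambda>i. if i < length xs then xs ! i else 0) 0)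
          ((\<lambda>i. if i < length xs then xs ! i else 0) 1))"
    by blast
  have C': "eval C [m, P, Y] r \<longleftrightarrow> r = of_bool (\<not> cond m P)" for m P Y r
    by (simp add: C)
  have "comput (\<lambda>e. out (e 0) (e 1) (e 2))"
    unfolding out_def by (intro h' comput_intros l') simp
  from comput_eval[OF this] obtain H where
    H: "\<And>xs r. eval H xs r \<longleftrightarrow> r = out ((\<lambda>i. if i < length xs then xs ! i else 0) 0)
          ((\<lambda>i. if i < length xs then xs ! i else 0) 1) ((\<lambda>i. if i < length xs then xs ! i else 0) 2)"
    by blast
  have H': "eval H [m, P, Y] r \<longleftrightarrow> r = out m P Y" for m P Y r
    by (simp add: H)
  \<comment> \<open>Only \<open>m = lead p\<close> can be valid, so the search stops there or, on an
    invalid \<open>p\<close>, diverges. This gives \<open>M\<close> its partial domain.\<close>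
  have Mn: "eval (Mn C) [bl_enc p, Y] m \<longleftrightarrow> valid m p" for p Y m
  proof -
    have "eval (Mn C) [bl_enc p, Y] m \<longleftrightarrow> valid m p \<and> (\<forall>k<m. \<not> valid k p)"
      using eval_Mn_total[where f = C and F = "\<lambda>k. of_bool (\<not> cond k (bl_enc p))", OF C']
      by (simp add: cond_iff)
    then show ?thesis by (auto simp: valid_def)
  qed
  have "eval (Comp H [Mn C, Proj 0, Proj 1]) [bl_enc p, bl_enc y] r \<longleftrightarrow>
      (\<exists>z. M p y = Some z \<and> r = bl_enc z)" for p y r
  proof -
    have "eval (Comp H [Mn C, Proj 0, Proj 1]) [bl_enc p, bl_enc y] r \<longleftrightarrow>
        (\<exists>m. valid m p \<and> eval H [m, bl_enc p, bl_enc y] r)"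
    proof
      assume "eval (Comp H [Mn C, Proj 0, Proj 1]) [bl_enc p, bl_enc y] r"
      then show "\<exists>m. valid m p \<and> eval H [m, bl_enc p, bl_enc y] r"
        unfolding eval_Comp_iff
        by (auto simp: length_Suc_conv All_less_Suc2 numeral_eq_Suc Mn eval_Proj_iff)
    next
      assume "\<exists>m. valid m p \<and> eval H [m, bl_enc p, bl_enc y] r"
      then obtain m where "valid m p" "eval H [m, bl_enc p, bl_enc y] r" by blast
      then show "eval (Comp H [Mn C, Proj 0, Proj 1]) [bl_enc p, bl_enc y] r"
        unfolding eval_Comp_iff
        by (intro exI[of _ "[m, bl_enc p, bl_enc y]"])
          (auto simp: All_less_Suc2 numeral_eq_Suc Mn eval_Proj_iff)
    qed
    also have "\<dots> \<longleftrightarrow> (\<exists>z. M p y = Some z \<and> r = bl_enc z)"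
      by (auto simp: H' M_def valid_def)
    finally show ?thesis .
  qed
  then have "partial_computable_machine M"
    unfolding partial_computable_machine_def by blast
  \<comment> \<open>The leading zeros of a valid program determine its length, and a valid program
    and its extension have the same leading zeros.\<close>
  moreover have "p = q" if "M p y \<noteq> None" "M q y \<noteq> None" "prefix p q" for p q y
  proof -
    have v: "valid (lead p) p" "valid (lead q) q"
      using that by (auto simp: M_def split: if_splits)
    then obtain u where u: "p = replicate (lead p) False @ True # u"
      unfolding valid_iff by blast
    from that(3) obtain w where w: "q = p @ w" by (auto simp: prefix_def)
    have "q = replicate (lead p) False @ True # (u @ w)"
      using u w by (metis append_Cons append_assoc)
    then have "lead q = lead p" by (metis lead_program)
    then have "length q = length p" using v by (simp add: valid_def)
    then show ?thesis using w by simp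
  qed
  ultimately have "prefix_free_machine M"
    unfolding prefix_free_machine_def by blast
  then obtain c where c: "\<And>p x y. M p y = Some x \<Longrightarrow> \<exists>q. U q y = Some x \<and> length q \<le> length p + c"
    using U unfolding universal_pf_machine_def by blast
  \<comment> \<open>The extra 1 in \<open>Suc c\<close> pays for the separator bit.\<close>
  have "\<exists>q. U q (str y) = Some (str (h m v y)) \<and> length q \<le> m + l m + Suc c" if "v < 2 ^ l m" for m v y
  proof -
    define u where "u = str (2 ^ l m + v - 1)"
    have u: "bl_enc u + 1 = 2 ^ l m + v"
      by (simp add: u_def)
    have "length u = l m"
      unfolding length_eq_bl_enc u using that by simp
    define p where "p = replicate m False @ True # u"
    have v: "valid m p" unfolding valid_iff p_def using \<open>length u = l m\<close> by blast
    have eq: "bl_enc p + 1 = 2 ^ m * (2 * (2 ^ l m + v) + 1)"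
      unfolding p_def bl_enc_program u ..
    have "(bl_enc p + 1) div 2 ^ Suc m = 2 ^ l m + v"
      unfolding eq power_Suc2 div_mult2_eq by simp
    then have "M p (str y) = Some (str (h m v y))"
      using v by (simp add: M_def out_def valid_def)
    from c[OF this] show ?thesis
      using v by (auto simp: valid_def)
  qed
  then show ?thesis by blast
qed

lemma card_shorter_lists: "card {p :: bool list. length p < n} < 2 ^ n"
  and finite_shorter_lists: "finite {p :: bool list. length p < n}"
proof -
  have "card {p :: bool list. length p < n} < 2 ^ n \<and> finite {p :: bool list. length p < n}"
  proof (induction n)
    case (Suc n)
    have eq: "{p :: bool list. length p < Suc n} = {p. length p < n} \<union> {p. length p = n}"
      by auto
    have "card {p :: bool list. length p = n} = 2 ^ n" "finite {p :: bool list. length p = n}"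
      using card_lists_length_eq[of "UNIV :: bool set" n]
        finite_lists_length_eq[of "UNIV :: bool set" n] by simp_all
    with Suc card_Un_le[of "{p :: bool list. length p < n}" "{p. length p = n}"]
    show ?case unfolding eq by simp
  qed simp
  then show "card {p :: bool list. length p < n} < 2 ^ n" "finite {p :: bool list. length p < n}"
    by blast+
qed

context
  fixes U :: machine
  assumes U: "universal_pf_machine U"
begin

lemma Kc_le_length: "U q y = Some x \<Longrightarrow> Kc U x y \<le> length q"
  unfolding Kc_def by (intro Least_le) auto

lemma Kc_upper_bound:
  assumes "comput (\<lambda>e. l (e 0))" and "comput (\<lambda>e. h (e 0) (e 1) (e 2))"
  shows "\<exists>c. \<forall>m v y. v < 2 ^ l m \<longrightarrow> Kc U (str (h m v y)) (str y) \<le> m + l m + c"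
proof -
  from universal_program[OF U assms] obtain c where c: "\<And>m v y. v < 2 ^ l m \<Longrightarrow>
    \<exists>q. U q (str y) = Some (str (h m v y)) \<and> length q \<le> m + l m + c" by blast
  show ?thesis
    using c Kc_le_length by (meson le_trans)
qed

text \<open>Shows that the \<open>LEAST\<close> in \<open>Kc\<close> ranges over a nonempty set:
  with block length 0 and output \<open>m\<close>, the unary part of a program alone names any
  string.\<close>

lemma Kc_witness: "\<exists>p. length p = Kc U x y \<and> U p y = Some x"
proof -
  have "\<exists>c. \<forall>m v y. v < (2::nat) ^ 0 \<longrightarrow> (\<exists>q. U q (str y) = Some (str m) \<and> length q \<le> m + 0 + c)"
    by (rule universal_program[OF U]) (intro comput_intros)+
  then have "\<exists>q. U q (str (bl_enc y)) = Some (str (bl_enc x))"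
    by (metis less_numeral_extra(1) power_0)
  then have "\<exists>n p. length p = n \<and> U p y = Some x" by simp
  then show ?thesis unfolding Kc_def by (rule LeastI_ex)
qed

text \<open>A halting empty program would, by prefix-freeness, be the only halting program for that
  condition, yet every string must be an output. This keeps the denominator of \<open>NID\<close>
  positive.\<close>

lemma Kc_pos: "Kc U x y > 0"
proof (rule ccontr)
  assume "\<not> Kc U x y > 0"
  then have x: "U [] y = Some x" using Kc_witness[of x y] by auto
  obtain p where p: "U p y = Some (True # x)" using Kc_witness[of "True # x" y] by blast
  have "[] = p"
    using U x p unfolding universal_pf_machine_def prefix_free_machine_def
    by (metis Nil_prefix option.distinct(1))
  with x p show False by simp
qed

text \<open>Choosing a shortest program for each string is injective, and fewer than
  \<open>2 ^ n\<close> programs are shorter than \<open>n\<close>.\<close>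

lemma count_simple_strings:
  "(\<Sum>p<N. of_bool (Kc U (str (a + p)) y < n)) \<le> (2::nat) ^ n"
proof -
  define A where "A = {p \<in> {..<N}. Kc U (str (a + p)) y < n}"
  define g where "g x = (SOME p. length p = Kc U x y \<and> U p y = Some x)" for x
  have g: "length (g x) = Kc U x y \<and> U (g x) y = Some x" for x
    unfolding g_def by (rule someI_ex) (rule Kc_witness)
  have "inj_on (\<lambda>p. g (str (a + p))) A"
  proof (intro inj_onI)
    fix p q assume eq: "g (str (a + p)) = g (str (a + q))"
    have "Some (str (a + p)) = U (g (str (a + p))) y"
      using g by (rule conjunct2[THEN sym])
    also have "\<dots> = Some (str (a + q))"
      unfolding eq using g by (rule conjunct2)
    finally show "p = q" by simp
  qed
  moreover have "(\<lambda>p. g (str (a + p))) ` A \<subseteq> {p. length p < n}"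
    by (auto simp: A_def conjunct1[OF g])
  ultimately have "card A \<le> card {p :: bool list. length p < n}"
    using finite_shorter_lists by (rule card_inj_on_le)
  also have "\<dots> \<le> 2 ^ n"
    using card_shorter_lists less_imp_le by blast
  also have "card A = (\<Sum>p<N. of_bool (Kc U (str (a + p)) y < n))"
    by (subst sum_of_bool_eq) (auto simp: A_def Int_def)
  finally show ?thesis .
qed

end

section \<open>Shapes bound the number of oscillations\<close>

text \<open>\<open>b\<close> tells whether the even positions are the high ones. Weak monotonicity
  of \<open>t\<close> is enough: values above 2/3 and below 1/3 alternate, so consecutive times
  below \<open>k\<close> differ anyway.\<close>

definition oscillates :: "(nat \<Rightarrow> rat) \<Rightarrow> bool \<Rightarrow> nat \<Rightarrow> bool" where
  "oscillates g b k \<longleftrightarrow> (\<exists>t. mono t \<and>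
     (\<forall>i<k. if even i = b then g (t i) > 2/3 else g (t i) < 1/3))"

lemma no_oscillation_on_monotone:
  fixes g :: "nat \<Rightarrow> rat" and t :: "nat \<Rightarrow> nat"
  assumes "mono_on A g \<or> antimono_on A g" "mono t" "t 0 \<in> A" "t 1 \<in> A" "t 2 \<in> A"
    and osc: "\<forall>i<k. if even i = b then g (t i) > 2/3 else g (t i) < 1/3" "2 < k"
  shows False
proof -
  have "t 0 \<le> t 1" "t 1 \<le> t 2" using assms(2) by (auto simp: mono_def)
  then have "g (t 0) \<le> g (t 1) \<and> g (t 1) \<le> g (t 2) \<or> g (t 1) \<le> g (t 0) \<and> g (t 2) \<le> g (t 1)"
    using assms(1,3-5) by (auto simp: monotone_on_def)
  moreover have "g (t 0) > 2/3 \<and> g (t 1) < 1/3 \<and> g (t 2) > 2/3 \<or>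
      g (t 0) < 1/3 \<and> g (t 1) > 2/3 \<and> g (t 2) < 1/3"
    using osc(1)[rule_format, of 0] osc(1)[rule_format, of 1] osc(1)[rule_format, of 2] osc(2)
    by (cases b) auto
  ultimately show False by auto
qed

text \<open>A monotone initial segment cannot contain the first three times, so \<open>t 2\<close>
  and all later times lie beyond \<open>s\<close>. Dropping two positions preserves parity, hence
  \<open>b\<close>.\<close>

lemma oscillates_shift:
  assumes "mono_on {..<s} g \<or> antimono_on {..<s} g" "oscillates g b k" "2 < k"
  shows "oscillates (\<lambda>t. g (t + s)) b (k - 2)"
proof -
  obtain t where t: "mono t" "\<forall>i<k. if even i = b then g (t i) > 2/3 else g (t i) < 1/3"
    using assms(2) by (auto simp: oscillates_def)
  have le: "t 0 \<le> t 1" "t 1 \<le> t 2" using t(1) by (auto simp: mono_def)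
  have "t 2 \<ge> s"
  proof (rule ccontr)
    assume "\<not> t 2 \<ge> s"
    then show False
      using no_oscillation_on_monotone[OF assms(1) t(1) _ _ _ t(2) assms(3)] le by auto
  qed
  then have ge: "t (i + 2) \<ge> s" for i
    using t(1) by (metis le_add2 le_trans monoD)
  show ?thesis unfolding oscillates_def
  proof (intro exI[of _ "\<lambda>i. t (i + 2) - s"] conjI allI impI)
    show "mono (\<lambda>i. t (i + 2) - s)"
      using t(1) by (auto simp: mono_def intro!: diff_le_mono)
    fix i assume "i < k - 2"
    then have "i + 2 < k" by simp
    moreover have parity: "even (i + 2) = even i" by simp
    ultimately show "if even i = b then 2 / 3 < g (t (i + 2) - s + s) else g (t (i + 2) - s + s) < 1 / 3"
      using t(2)[rule_format, of "i + 2"] unfolding parity le_add_diff_inverse2[OF ge] by blast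
  qed
qed

text \<open>Each monotone phase uses up at most two alternations. Both shapes are treated at once
  because their recursion swaps them.\<close>

lemma shape_oscillation_bound:
  assumes "sig_shape n g \<or> pi_shape n g" "oscillates g b k"
  shows "k \<le> 2 * n"
  using assms
proof (induction n arbitrary: g k)
  case (Suc n)
  show ?case
  proof (rule ccontr)
    assume "\<not> k \<le> 2 * Suc n"
    then have k: "2 < k" "\<not> k - 2 \<le> 2 * n" by auto
    show False
    proof (cases n)
      case 0
      then have "mono_on UNIV g \<or> antimono_on UNIV g" using Suc.prems(1) by auto
      then show False
        using Suc.prems(2) k(1) no_oscillation_on_monotone[of UNIV g] unfolding oscillates_def by blast
    next
      case (Suc n')
      then obtain s where s: "mono_on {..<s} g \<or> antimono_on {..<s} g"
        "sig_shape n (\<lambda>t. g (t + s)) \<or> pi_shape n (\<lambda>t. g (t + s))"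
        using Suc.prems(1) by auto
      from Suc.IH[OF s(2) oscillates_shift[OF s(1) Suc.prems(2) k(1)]] k(2) show False by simp
    qed
  qed
qed simp

section \<open>Deciding the thresholds\<close>

text \<open>Doubling clears the division in the triangular number, so that pairing is described by a
  polynomial equation.\<close>

lemma double_prod_encode: "2 * prod_encode (m, n) = (m + n) * (m + n + 1) + 2 * m"
proof -
  have "even ((m + n) * Suc (m + n))" by simp
  then show ?thesis by (simp add: prod_encode_def triangle_def)
qed

lemma int_encode_eq_even: "int_encode i = 2 * a \<longleftrightarrow> i = int a"
proof -
  have "int_encode (int a) = 2 * a" by (simp add: int_encode_def sum_encode_def)
  then show ?thesis by (metis inj_int_encode injD)
qed

text \<open>Under \<open>int_encode\<close> the nonnegative integers are exactly the ones with an even code.\<close>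

lemma rat_enc_decode:
  "(\<exists>a\<le>rat_enc q. \<exists>b\<le>rat_enc q.
      2 * rat_enc q = (2 * a + 2 * b) * (2 * a + 2 * b + 1) + 2 * (2 * a) \<and> P a b) \<longleftrightarrow>
   (\<exists>a b. quotient_of q = (int a, int b) \<and> P a b)" (is "?L \<longleftrightarrow> ?R")
proof -
  have *: "2 * rat_enc q = (2 * a + 2 * b) * (2 * a + 2 * b + 1) + 2 * (2 * a) \<longleftrightarrow>
      quotient_of q = (int a, int b)" for a b
  proof -
    have "2 * rat_enc q = (2 * a + 2 * b) * (2 * a + 2 * b + 1) + 2 * (2 * a) \<longleftrightarrow>
        rat_enc q = prod_encode (2 * a, 2 * b)"
      unfolding double_prod_encode[symmetric] by linarith
    also have "\<dots> \<longleftrightarrow> quotient_of q = (int a, int b)"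
      unfolding rat_enc_def prod_encode_eq by (auto simp: int_encode_eq_even prod_eq_iff)
    finally show ?thesis .
  qed
  \<comment> \<open>A pair code dominates both components, which is why the bounded search misses
    nothing.\<close>
  have "a \<le> rat_enc q \<and> b \<le> rat_enc q" if "quotient_of q = (int a, int b)" for a b
  proof -
    have "rat_enc q = prod_encode (2 * a, 2 * b)"
      using that by (simp add: rat_enc_def int_encode_eq_even)
    then show ?thesis
      using le_prod_encode_1[of "2 * a" "2 * b"] le_prod_encode_2[of "2 * b" "2 * a"] by linarith
  qed
  then show ?thesis unfolding * by blast
qed

lemma quotient_of_fraction:
  obtains p d where "quotient_of q = (p, d)" "d > 0" "q = of_int p / of_int d"
proof -
  obtain p d where "quotient_of q = (p, d)" by fastforce
  then show thesis using that quotient_of_div quotient_of_denom_pos by blast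
qed

lemma rat_gt_iff: "2/3 < q \<longleftrightarrow> (\<exists>a b. quotient_of q = (int a, int b) \<and> 2 * b < 3 * a)"
proof -
  obtain p d where q: "quotient_of q = (p, d)" "d > 0" "q = of_int p / of_int d"
    by (rule quotient_of_fraction)
  have "2/3 < q \<longleftrightarrow> 2 * (of_int d :: rat) < 3 * of_int p"
    using q(2) by (simp add: q(3) field_simps)
  also have "\<dots> \<longleftrightarrow> 2 * d < 3 * p"
    by (metis of_int_less_iff of_int_mult of_int_numeral)
  also have "\<dots> \<longleftrightarrow> (\<exists>a b. p = int a \<and> d = int b \<and> 2 * b < 3 * a)"
  proof
    assume "2 * d < 3 * p"
    then show "\<exists>a b. p = int a \<and> d = int b \<and> 2 * b < 3 * a"
      using q(2) by (intro exI[of _ "nat p"] exI[of _ "nat d"]) auto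
  qed auto
  finally show ?thesis using q(1) by simp
qed

text \<open>The negated form takes care of negative \<open>q\<close>: the complementary condition
  \<open>1/3 <= q\<close> forces a positive numerator, which a natural number can represent.\<close>

lemma rat_lt_iff: "q < 1/3 \<longleftrightarrow> \<not> (\<exists>a b. quotient_of q = (int a, int b) \<and> b \<le> 3 * a)"
proof -
  obtain p d where q: "quotient_of q = (p, d)" "d > 0" "q = of_int p / of_int d"
    by (rule quotient_of_fraction)
  have "\<not> q < 1/3 \<longleftrightarrow> (of_int d :: rat) \<le> 3 * of_int p"
    using q(2) by (simp add: q(3) field_simps not_less)
  also have "\<dots> \<longleftrightarrow> d \<le> 3 * p"
    by (metis of_int_le_iff of_int_mult of_int_numeral)
  also have "\<dots> \<longleftrightarrow> (\<exists>a b. p = int a \<and> d = int b \<and> b \<le> 3 * a)"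
  proof
    assume "d \<le> 3 * p"
    then show "\<exists>a b. p = int a \<and> d = int b \<and> b \<le> 3 * a"
      using q(2) by (intro exI[of _ "nat p"] exI[of _ "nat d"]) auto
  qed auto
  finally show ?thesis using q(1) by auto
qed

lemma comput_rat_threshold:
  assumes "comput (\<lambda>e. rat_enc (F e))"
  shows "comput (\<lambda>e. of_bool (2/3 < F e))" and "comput (\<lambda>e. of_bool (F e < 1/3))"
proof -
  have "comput (\<lambda>e. of_bool (\<exists>a\<le>e 0. \<exists>b\<le>e 0.
      2 * e 0 = (2 * a + 2 * b) * (2 * a + 2 * b + 1) + 2 * (2 * a) \<and> 2 * b < 3 * a))"
    by (intro comput_intros)
  from comput_subst1[OF this assms] show "comput (\<lambda>e. of_bool (2/3 < F e))"
    unfolding rat_enc_decode rat_gt_iff .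
  have "comput (\<lambda>e. of_bool (\<not> (\<exists>a\<le>e 0. \<exists>b\<le>e 0.
      2 * e 0 = (2 * a + 2 * b) * (2 * a + 2 * b + 1) + 2 * (2 * a) \<and> b \<le> 3 * a)))"
    by (intro comput_intros)
  from comput_subst1[OF this assms] show "comput (\<lambda>e. of_bool (F e < 1/3))"
    unfolding rat_enc_decode rat_lt_iff .
qed

section \<open>Squares of pairs with many oscillations\<close>

lemma sum_le_average:
  fixes X :: "nat \<Rightarrow> nat"
  assumes "C * (\<Sum>j<R. X j) \<le> R * T" "R > 0"
  shows "\<exists>j<R. C * X j \<le> T"
proof (rule ccontr)
  assume "\<not> (\<exists>j<R. C * X j \<le> T)"
  then have "(\<Sum>j<R. T) < (\<Sum>j<R. C * X j)"
    using assms(2) by (intro sum_strict_mono) (auto simp: not_le)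
  then show False using assms(1) by (simp add: sum_distrib_left)
qed

lemma sum_blocks: "(\<Sum>p<R * D. g p) = (\<Sum>i<R. \<Sum>u<D. g (i * D + u))"
  for g :: "nat \<Rightarrow> nat"
proof -
  have "(\<Sum>u<D. g (i * D + u)) = sum g {i * D..<i * D + D}" for i
    using sum.shift_bounds_nat_ivl[of g 0 "i * D" D] by (simp add: lessThan_atLeast0 add.commute)
  then show ?thesis by (simp add: sum.nat_group)
qed

text \<open>Blocks are matched by the involution \<open>i \<mapsto> j - i\<close> modulo \<open>R\<close>.\<close>

definition partner :: "nat \<Rightarrow> nat \<Rightarrow> nat \<Rightarrow> nat" where
  "partner R j i = (j + R - i) mod R"

lemma partner_less [simp]: "R > 0 \<Longrightarrow> partner R j i < R"
  by (simp add: partner_def)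

lemma partner_cases:
  "j < R \<Longrightarrow> i < R \<Longrightarrow> partner R j i = (if i \<le> j then j - i else j + R - i)"
proof (cases "i \<le> j")
  case True
  assume "j < R"
  have "j + R - i = (j - i) + R" using True by simp
  then have "partner R j i = (j - i) mod R" unfolding partner_def by simp
  then show ?thesis using True \<open>j < R\<close> by simp
qed (simp add: partner_def)

lemma partner_partner: "j < R \<Longrightarrow> i < R \<Longrightarrow> partner R j (partner R j i) = i"
  using partner_less[of R j i] by (subst partner_cases) (auto simp: partner_cases split: if_splits)

text \<open>For fixed \<open>i\<close>, the map from \<open>j\<close> to
  \<open>partner R j i\<close> permutes the residues; its inverse adds \<open>i\<close> modulo
  \<open>R\<close>.\<close>

lemma sum_partner:
  assumes "i < R"
  shows "(\<Sum>j<R. g (partner R j i)) = (\<Sum>q<R. g q :: nat)"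
proof (rule sum.reindex_bij_witness[of _ "\<lambda>q. if q + i < R then q + i else q + i - R"
      "\<lambda>j. partner R j i"])
qed (use assms in \<open>auto simp: partner_cases split: if_splits\<close>)

text \<open>Every pair of blocks \<open>(i, q)\<close> is matched for exactly one \<open>j\<close>,
  namely \<open>i + q\<close> modulo \<open>R\<close>. The \<open>R\<close> matchings therefore
  partition the square into bands.\<close>

lemma sum_bands:
  fixes g :: "nat \<Rightarrow> nat \<Rightarrow> nat"
  shows "(\<Sum>p<R * D. \<Sum>q<R * D. g p q) =
    (\<Sum>j<R. \<Sum>i<R. \<Sum>u<D. \<Sum>v<D. g (i * D + u) (partner R j i * D + v))"
proof -
  have "(\<Sum>p<R * D. \<Sum>q<R * D. g p q) = (\<Sum>i<R. \<Sum>u<D. \<Sum>q<R. \<Sum>v<D. g (i * D + u) (q * D + v))"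
    unfolding sum_blocks ..
  also have "\<dots> = (\<Sum>i<R. \<Sum>q<R. \<Sum>u<D. \<Sum>v<D. g (i * D + u) (q * D + v))"
    by (intro sum.cong refl sum.swap)
  also have "\<dots> = (\<Sum>i<R. \<Sum>j<R. \<Sum>u<D. \<Sum>v<D. g (i * D + u) (partner R j i * D + v))"
    by (intro sum.cong refl sum_partner[symmetric, where g = "\<lambda>q. \<Sum>u<D. \<Sum>v<D. g (_ * D + u) (q * D + v)"]) simp
  also have "\<dots> = (\<Sum>j<R. \<Sum>i<R. \<Sum>u<D. \<Sum>v<D. g (i * D + u) (partner R j i * D + v))"
    by (rule sum.swap)
  finally show ?thesis .
qed

section \<open>Thresholds passed by the approximation\<close>

locale NID_approximation =
  fixes U :: machine and f :: "bool list \<Rightarrow> bool list \<Rightarrow> nat \<Rightarrow> rat"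
  assumes U: "universal_pf_machine U" and f: "approximates f (NID U)"
begin

text \<open>A finite-stage form of an oscillation that starts high. The stage bounds all
  quantifiers, so it is decidable.\<close>

primrec osc :: "nat \<Rightarrow> nat \<Rightarrow> nat \<Rightarrow> nat \<Rightarrow> bool" where
  "osc 0 x y s \<longleftrightarrow> True"
| "osc (Suc k) x y s \<longleftrightarrow> (\<exists>t\<le>s. osc k x y t \<and>
     (if even k then 2/3 < f (str x) (str y) t else f (str x) (str y) t < 1/3))"

text \<open>Unlike \<open>osc\<close> at a stage, this refers to the whole run. Being a number, it
  can be summed to count the failing pairs of a square.\<close>

definition miss :: "nat \<Rightarrow> nat \<Rightarrow> nat \<Rightarrow> nat" where
  "miss k x y = of_bool (\<forall>s. \<not> osc k x y s)"

lemma comput_approx: "comput (\<lambda>e. rat_enc (f (str (e 0)) (str (e 1)) (e 2)))"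
proof -
  obtain c where "\<And>x y s r. eval c [bl_enc x, bl_enc y, s] r \<longleftrightarrow> r = rat_enc (f x y s)"
    using f unfolding approximates_def computable_approx_def by blast
  from this[of "str _" "str _"] show ?thesis
    unfolding comput_def
    by (intro exI[of _ 3] exI[of _ c]) (simp add: numeral_eq_Suc)
qed

lemma comput_osc: "comput (\<lambda>e. of_bool (osc k (e 0) (e 1) (e 2)))"
proof (induction k)
  case 0
  show ?case by (simp add: comput_const)
next
  case (Suc k)
  note osc' = comput_subst3[where F = "\<lambda>x y s. of_bool (osc k x y s)", OF Suc]
  note thr = comput_rat_threshold[OF comput_subst3[where F = "\<lambda>x y s. rat_enc (f (str x) (str y) s)",
        OF comput_approx]]
  show ?case
  proof (cases "even k")
    case True
    have "comput (\<lambda>e. of_bool (\<exists>t\<le>e 2. osc k (e 0) (e 1) t \<and> 2/3 < f (str (e 0)) (str (e 1)) t))"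
      by (intro comput_bex comput_conj osc' thr comput_var)
    then show ?thesis using True by simp
  next
    case False
    have "comput (\<lambda>e. of_bool (\<exists>t\<le>e 2. osc k (e 0) (e 1) t \<and> f (str (e 0)) (str (e 1)) t < 1/3))"
      by (intro comput_bex comput_conj osc' thr comput_var)
    then show ?thesis using False by simp
  qed
qed

lemma osc_mono: "osc k x y s \<Longrightarrow> s \<le> s' \<Longrightarrow> osc k x y s'"
  by (cases k) (simp, simp only: osc.simps, meson le_trans)

text \<open>As \<open>osc\<close> is monotone in the stage, one stage serves a whole finite set; a
  true bound on the misses is thus eventually observed.\<close>

lemma osc_stabilizes:
  assumes "finite P"
  shows "\<exists>s. \<forall>(x, y)\<in>P. of_bool (\<not> osc k x y s) = miss k x y"
  using assms
proof induction
  case (insert p P)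
  obtain x y where p: "p = (x, y)" by fastforce
  obtain s where s: "\<forall>(x, y)\<in>P. of_bool (\<not> osc k x y s) = miss k x y"
    using insert.IH by blast
  obtain t where t: "(\<exists>s. osc k x y s) \<longrightarrow> osc k x y t" by blast
  have stable: "of_bool (\<not> osc k x y (max s t)) = miss k x y"
    if "(\<exists>s. osc k x y s) \<longrightarrow> osc k x y s \<or> osc k x y t" for x y
    using that osc_mono[of k x y s "max s t"] osc_mono[of k x y t "max s t"]
    unfolding miss_def by (intro arg_cong[of _ _ of_bool]) auto
  have "of_bool (\<not> osc k x y (max s t)) = miss k x y" if "(x, y) \<in> P" for x y
  proof (rule stable)
    have "of_bool (\<not> osc k x y s) = miss k x y" using s that by blast
    then show "(\<exists>s. osc k x y s) \<longrightarrow> osc k x y s \<or> osc k x y t"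
      unfolding miss_def of_bool_eq_iff by blast
  qed
  then have "\<forall>(x, y)\<in>P. of_bool (\<not> osc k x y (max s t)) = miss k x y" by blast
  moreover have "of_bool (\<not> osc k x y (max s t)) = miss k x y" using t by (intro stable) blast
  ultimately show ?case
    unfolding p by (intro exI[of _ "max s t"]) simp
qed simp

text \<open>If \<open>k\<close> thresholds have been passed, a limit strictly beyond the next one
  forces the approximation past it at some later stage.\<close>

lemma miss_Suc_le:
  assumes "if even k then 2/3 < NID U (str x) (str y) else NID U (str x) (str y) < 1/3"
  shows "miss (Suc k) x y \<le> miss k x y"
proof (cases "\<exists>s. osc k x y s")
  case True
  then obtain s where s: "osc k x y s" by blast
  define g where "g = f (str x) (str y)"
  have lim: "(\<lambda>s. real_of_rat (g s)) \<longlonglongrightarrow> real_of_rat (NID U (str x) (str y))"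
    using f unfolding approximates_def g_def by blast
  have "\<forall>\<^sub>F t in sequentially. if even k then 2/3 < g t else g t < 1/3"
  proof (cases "even k")
    case True
    then have "real_of_rat (2/3) < real_of_rat (NID U (str x) (str y))"
      using assms by (simp only: of_rat_less if_True if_False)
    from order_tendstoD(1)[OF lim this] show ?thesis
      using True by (simp only: of_rat_less if_True)
  next
    case False
    then have "real_of_rat (NID U (str x) (str y)) < real_of_rat (1/3)"
      using assms by (simp only: of_rat_less if_True if_False)
    from order_tendstoD(2)[OF lim this] show ?thesis
      using False by (simp only: of_rat_less if_False)
  qed
  then obtain t where "t \<ge> s" "if even k then 2/3 < g t else g t < 1/3"
    unfolding eventually_sequentially by (metis nat_le_linear)
  then have "osc (Suc k) x y t"
    using osc_mono[OF s] unfolding g_def by auto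
  then show ?thesis unfolding miss_def by (auto simp del: osc.simps)
qed (simp add: miss_def)

text \<open>Misses counted at a finite stage only overestimate the true misses, so a stage count
  within \<open>T m\<close> certifies the bound. General \<open>X\<close> and \<open>Y\<close> let
  the lemma select both a matching and a single pair of blocks.\<close>

lemma select_index:
  assumes X: "comput (\<lambda>e. X (e 0) (e 1) (e 2) (e 3))" and Y: "comput (\<lambda>e. Y (e 0) (e 1) (e 2) (e 3))"
    and A: "comput (\<lambda>e. A (e 0))" and D: "comput (\<lambda>e. D (e 0))"
    and R: "comput (\<lambda>e. R (e 0))" and T: "comput (\<lambda>e. T (e 0))"
    and ex: "\<And>m. m \<ge> m0 \<Longrightarrow> \<exists>j<R m.
      2 ^ c * (\<Sum>i<A m. \<Sum>u<D m. \<Sum>v<D m. miss k (X m j i u) (Y m j i v)) \<le> T m"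
  shows "\<exists>J. comput (\<lambda>e. J (e 0)) \<and> (\<forall>m\<ge>m0. J m < R m \<and>
      2 ^ c * (\<Sum>i<A m. \<Sum>u<D m. \<Sum>v<D m. miss k (X m (J m) i u) (Y m (J m) i v)) \<le> T m)"
proof -
  \<comment> \<open>The disjunct \<open>m < m0\<close> keeps the search total where
    \<open>ex\<close> gives nothing.\<close>
  define Q where "Q m j s \<longleftrightarrow> m < m0 \<or> (j < R m \<and>
    2 ^ c * (\<Sum>i<A m. \<Sum>u<D m. \<Sum>v<D m. of_bool (\<not> osc k (X m j i u) (Y m j i v) s)) \<le> T m)"
    for m j s
  note osc' = comput_subst3[where F = "\<lambda>x y s. of_bool (osc k x y s)", OF comput_osc]
  have "comput (\<lambda>e. of_bool (Q (e 0) (e 1) (e 2)))"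
    unfolding Q_def
    by (intro comput_intros osc' comput_subst4[OF X] comput_subst4[OF Y] comput_subst1[OF A]
        comput_subst1[OF D] comput_subst1[OF R] comput_subst1[OF T])
  moreover have "\<exists>j s. Q m j s" for m
  proof (cases "m < m0")
    case False
    then obtain j where j: "j < R m"
      "2 ^ c * (\<Sum>i<A m. \<Sum>u<D m. \<Sum>v<D m. miss k (X m j i u) (Y m j i v)) \<le> T m"
      using ex[of m] by auto
    have "finite ((\<lambda>(i, u, v). (X m j i u, Y m j i v)) ` ({..<A m} \<times> {..<D m} \<times> {..<D m}))"
      by simp
    from osc_stabilizes[OF this, of k] obtain s where
      "\<And>i u v. i < A m \<Longrightarrow> u < D m \<Longrightarrow> v < D m \<Longrightarrow>
        of_bool (\<not> osc k (X m j i u) (Y m j i v) s) = miss k (X m j i u) (Y m j i v)"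
      by force
    then have "(\<Sum>i<A m. \<Sum>u<D m. \<Sum>v<D m. of_bool (\<not> osc k (X m j i u) (Y m j i v) s)) =
        (\<Sum>i<A m. \<Sum>u<D m. \<Sum>v<D m. miss k (X m j i u) (Y m j i v))"
      by (intro sum.cong refl) simp
    then have "Q m j s" using j unfolding Q_def by (intro disjI2 conjI) (simp_all only:)
    then show ?thesis by blast
  qed (simp add: Q_def)
  ultimately obtain J where J: "comput (\<lambda>e. J (e 0))" "\<And>m. \<exists>s. Q m (J m) s"
    using comput_select[of Q] by blast
  have "J m < R m \<and>
      2 ^ c * (\<Sum>i<A m. \<Sum>u<D m. \<Sum>v<D m. miss k (X m (J m) i u) (Y m (J m) i v)) \<le> T m"
    if "m \<ge> m0" for m
  proof -
    have "\<not> m < m0" using that by simp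
    then obtain s where s: "J m < R m" "2 ^ c * (\<Sum>i<A m. \<Sum>u<D m. \<Sum>v<D m.
        of_bool (\<not> osc k (X m (J m) i u) (Y m (J m) i v) s)) \<le> T m"
      using J(2)[of m] unfolding Q_def by blast
    have "miss k x y \<le> of_bool (\<not> osc k x y s)" for x y
      by (auto simp: miss_def)
    then have "2 ^ c * (\<Sum>i<A m. \<Sum>u<D m. \<Sum>v<D m. miss k (X m (J m) i u) (Y m (J m) i v)) \<le>
        2 ^ c * (\<Sum>i<A m. \<Sum>u<D m. \<Sum>v<D m. of_bool (\<not> osc k (X m (J m) i u) (Y m (J m) i v) s))"
      by (intro mult_left_mono sum_mono) auto
    with s show ?thesis by linarith
  qed
  with J(1) show ?thesis by blast
qed

section \<open>From complexity bounds to the next threshold\<close>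

lemma NID_gt:
  assumes "E \<le> Kc U x y" "Kp U x \<le> B" "Kp U y \<le> B" "2 * B < 3 * E"
  shows "2/3 < NID U x y"
proof -
  define n d where "n = max (Kc U x y) (Kc U y x)" and "d = max (Kp U x) (Kp U y)"
  have "d > 0" unfolding d_def Kp_def using Kc_pos[OF U] by (simp add: less_max_iff_disj)
  have "2 * d < 3 * n" using assms unfolding n_def d_def by linarith
  then have "2 * (of_nat d :: rat) < 3 * of_nat n"
    by (metis of_nat_less_iff of_nat_mult of_nat_numeral)
  then show ?thesis
    using \<open>d > 0\<close> unfolding NID_def n_def[symmetric] d_def[symmetric] by (simp add: field_simps)
qed

lemma NID_lt:
  assumes "Kc U x y \<le> B" "Kc U y x \<le> B" "E \<le> Kp U x" "3 * B < E"
  shows "NID U x y < 1/3"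
proof -
  define n d where "n = max (Kc U x y) (Kc U y x)" and "d = max (Kp U x) (Kp U y)"
  have "3 * n < d" using assms unfolding n_def d_def by linarith
  moreover from this have "3 * (of_nat n :: rat) < of_nat d"
    by (metis of_nat_less_iff of_nat_mult of_nat_numeral)
  ultimately show ?thesis
    unfolding NID_def n_def[symmetric] d_def[symmetric] by (simp add: field_simps)
qed

text \<open>For each second component, at most a fraction \<open>2^-c\<close> of the first
  components have conditional complexity below \<open>M m - c\<close>. For all other pairs NID is at
  least about 8/9, since the plain complexities are at most \<open>m + M m\<close> plus a constant
  and \<open>m\<close> is at most \<open>M m / 8\<close>.\<close>

lemma square_step:
  assumes a: "comput (\<lambda>e. a (e 0))" and b: "comput (\<lambda>e. b (e 0))" and M: "comput (\<lambda>e. M (e 0))"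
    and M8: "\<And>m. 8 * m \<le> M m" and "even k"
  shows "\<exists>m0. \<forall>m\<ge>m0.
    2 ^ c * (\<Sum>p<2 ^ M m. \<Sum>q<2 ^ M m. miss (Suc k) (a m + p) (b m + q)) \<le>
    2 ^ c * (\<Sum>p<2 ^ M m. \<Sum>q<2 ^ M m. miss k (a m + p) (b m + q)) + 2 ^ M m * 2 ^ M m"
proof -
  have "\<exists>C. \<forall>m v y. v < 2 ^ M m \<longrightarrow> Kc U (str (a m + v)) (str y) \<le> m + M m + C"
    by (rule Kc_upper_bound[OF U M]) (intro comput_intros comput_subst1[OF a])
  then obtain Ca where Ca: "\<And>m v y. v < 2 ^ M m \<Longrightarrow> Kc U (str (a m + v)) (str y) \<le> m + M m + Ca"
    by blast
  have "\<exists>C. \<forall>m v y. v < 2 ^ M m \<longrightarrow> Kc U (str (b m + v)) (str y) \<le> m + M m + C"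
    by (rule Kc_upper_bound[OF U M]) (intro comput_intros comput_subst1[OF b])
  then obtain Cb where Cb: "\<And>m v y. v < 2 ^ M m \<Longrightarrow> Kc U (str (b m + v)) (str y) \<le> m + M m + Cb"
    by blast
  show ?thesis
  proof (intro exI[of _ "3 * c + 2 * Ca + 2 * Cb + 1"] allI impI)
    fix m assume m: "m \<ge> 3 * c + 2 * Ca + 2 * Cb + 1"
    let ?N = "2 ^ M m :: nat"
    let ?simple = "\<lambda>p q. of_bool (Kc U (str (a m + p)) (str (b m + q)) < M m - c) :: nat"
    have cM: "c \<le> M m" using m M8[of m] by linarith
    have point: "miss (Suc k) (a m + p) (b m + q) \<le> miss k (a m + p) (b m + q) + ?simple p q"
      if "p < ?N" "q < ?N" for p q
    proof (cases "Kc U (str (a m + p)) (str (b m + q)) < M m - c")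
      case False
      have "2/3 < NID U (str (a m + p)) (str (b m + q))"
      proof (rule NID_gt)
        show "M m - c \<le> Kc U (str (a m + p)) (str (b m + q))" using False by simp
        show "Kp U (str (a m + p)) \<le> m + M m + Ca + Cb"
          using Ca[OF that(1), of 0] by (simp add: Kp_def)
        show "Kp U (str (b m + q)) \<le> m + M m + Ca + Cb"
          using Cb[OF that(2), of 0] by (simp add: Kp_def)
        show "2 * (m + M m + Ca + Cb) < 3 * (M m - c)"
          using m M8[of m] le_Suc_ex[OF cM] by auto
      qed
      then show ?thesis using miss_Suc_le[of k] \<open>even k\<close> by (simp add: trans_le_add1)
    qed (simp add: miss_def)
    \<comment> \<open>Counting programs requires a fixed condition, so the second component moves to
      the outer sum.\<close>
    have "(\<Sum>p<?N. \<Sum>q<?N. ?simple p q) = (\<Sum>q<?N. \<Sum>p<?N. ?simple p q)"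
      by (rule sum.swap)
    also have "\<dots> \<le> (\<Sum>q<?N. 2 ^ (M m - c))"
      by (intro sum_mono count_simple_strings[OF U])
    finally have "2 ^ c * (\<Sum>p<?N. \<Sum>q<?N. ?simple p q) \<le> 2 ^ c * (?N * 2 ^ (M m - c))"
      by simp
    also have "\<dots> = ?N * ?N"
      using cM by (simp add: power_add[symmetric])
    finally have few: "2 ^ c * (\<Sum>p<?N. \<Sum>q<?N. ?simple p q) \<le> ?N * ?N" .
    have "(\<Sum>p<?N. \<Sum>q<?N. miss (Suc k) (a m + p) (b m + q)) \<le>
        (\<Sum>p<?N. \<Sum>q<?N. miss k (a m + p) (b m + q) + ?simple p q)"
      using point by (intro sum_mono) auto
    also have "\<dots> = (\<Sum>p<?N. \<Sum>q<?N. miss k (a m + p) (b m + q)) + (\<Sum>p<?N. \<Sum>q<?N. ?simple p q)"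
      by (simp only: sum.distrib)
    finally have "2 ^ c * (\<Sum>p<?N. \<Sum>q<?N. miss (Suc k) (a m + p) (b m + q)) \<le>
        2 ^ c * ((\<Sum>p<?N. \<Sum>q<?N. miss k (a m + p) (b m + q)) + (\<Sum>p<?N. \<Sum>q<?N. ?simple p q))"
      by (rule mult_left_mono) simp
    with few show "2 ^ c * (\<Sum>p<?N. \<Sum>q<?N. miss (Suc k) (a m + p) (b m + q)) \<le>
        2 ^ c * (\<Sum>p<?N. \<Sum>q<?N. miss k (a m + p) (b m + q)) + ?N * ?N"
      unfolding distrib_left by linarith
  qed
qed

text \<open>The condition reveals its own block index by division, and \<open>J\<close> then yields
  the partner block. Only the position \<open>u\<close> inside that block has to be supplied, at a
  cost of \<open>l m\<close> bits.\<close>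

lemma partner_block_bound:
  assumes a: "comput (\<lambda>e. a (e 0))" and b: "comput (\<lambda>e. b (e 0))" and J: "comput (\<lambda>e. J (e 0))"
    and l: "comput (\<lambda>e. l (e 0))" and R: "comput (\<lambda>e. R (e 0))" "\<And>m. R m > 0"
  shows "\<exists>C. \<forall>m q u v. u < 2 ^ l m \<longrightarrow> v < 2 ^ l m \<longrightarrow>
    Kc U (str (a m + (partner (R m) (J m) q * 2 ^ l m + u))) (str (b m + (q * 2 ^ l m + v))) \<le> m + l m + C"
proof -
  define h where "h m u y = a m + (partner (R m) (J m) ((y - b m) div 2 ^ l m) * 2 ^ l m + u)" for m u y
  have "comput (\<lambda>e. h (e 0) (e 1) (e 2))"
    unfolding h_def partner_def
    by (intro comput_intros comput_subst1[OF a] comput_subst1[OF b] comput_subst1[OF J]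
        comput_subst1[OF l] comput_subst1[OF R(1)]) (simp_all add: R(2))
  from Kc_upper_bound[OF U l this] obtain C where
    C: "\<And>m u y. u < 2 ^ l m \<Longrightarrow> Kc U (str (h m u y)) (str y) \<le> m + l m + C" by blast
  have "h m u (b m + (q * 2 ^ l m + v)) = a m + (partner (R m) (J m) q * 2 ^ l m + u)"
    if "v < 2 ^ l m" for m q u v
    using that by (simp add: h_def)
  with C show ?thesis by metis
qed

text \<open>Both conditional complexities are at most about \<open>9/8 * l m\<close>, while all but
  a fraction \<open>2^-c\<close> of the first components have complexity at least
  \<open>8 * l m - c\<close>. One complex component is enough, as the denominator of NID is a
  maximum.\<close>

lemma band_step:
  assumes a: "comput (\<lambda>e. a (e 0))" and b: "comput (\<lambda>e. b (e 0))" and J: "comput (\<lambda>e. J (e 0))"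
    and l: "comput (\<lambda>e. l (e 0))" and l8: "\<And>m. 8 * m \<le> l m" and "odd k"
    and Jless: "\<And>m. m \<ge> m0 \<Longrightarrow> J m < 2 ^ (7 * l m)"
  shows "\<exists>m1\<ge>m0. \<forall>m\<ge>m1.
    2 ^ c * (\<Sum>i<2 ^ (7 * l m). \<Sum>u<2 ^ l m. \<Sum>v<2 ^ l m.
      miss (Suc k) (a m + (i * 2 ^ l m + u)) (b m + (partner (2 ^ (7 * l m)) (J m) i * 2 ^ l m + v))) \<le>
    2 ^ c * (\<Sum>i<2 ^ (7 * l m). \<Sum>u<2 ^ l m. \<Sum>v<2 ^ l m.
      miss k (a m + (i * 2 ^ l m + u)) (b m + (partner (2 ^ (7 * l m)) (J m) i * 2 ^ l m + v))) +
    2 ^ (7 * l m) * (2 ^ l m * 2 ^ l m)"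
proof -
  have R: "comput (\<lambda>e. 2 ^ (7 * l (e 0)))"
    by (intro comput_intros l)
  have Rpos: "0 < (2::nat) ^ (7 * l m)" for m by simp
  obtain C1 where C1: "\<And>m q u v. u < 2 ^ l m \<Longrightarrow> v < 2 ^ l m \<Longrightarrow>
      Kc U (str (a m + (partner (2 ^ (7 * l m)) (J m) q * 2 ^ l m + u))) (str (b m + (q * 2 ^ l m + v)))
        \<le> m + l m + C1"
    using partner_block_bound[OF a b J l R Rpos] by blast
  obtain C2 where C2: "\<And>m q u v. u < 2 ^ l m \<Longrightarrow> v < 2 ^ l m \<Longrightarrow>
      Kc U (str (b m + (partner (2 ^ (7 * l m)) (J m) q * 2 ^ l m + u))) (str (a m + (q * 2 ^ l m + v)))
        \<le> m + l m + C2"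
    using partner_block_bound[OF b a J l R Rpos] by blast
  show ?thesis
  proof (intro exI[of _ "m0 + c + 3 * C1 + 3 * C2 + 1"] conjI allI impI)
    fix m assume m: "m \<ge> m0 + c + 3 * C1 + 3 * C2 + 1"
    let ?R = "2 ^ (7 * l m) :: nat" and ?D = "2 ^ l m :: nat"
    let ?\<pi> = "partner ?R (J m)"
    let ?simple = "\<lambda>p. of_bool (Kc U (str (a m + p)) (str 0) < 8 * l m - c) :: nat"
    have cM: "c \<le> 8 * l m" using m l8[of m] by linarith
    have point: "miss (Suc k) (a m + (i * ?D + u)) (b m + (?\<pi> i * ?D + v)) \<le>
        miss k (a m + (i * ?D + u)) (b m + (?\<pi> i * ?D + v)) + ?simple (i * ?D + u)"
      if "i < ?R" "u < ?D" "v < ?D" for i u v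
    proof (cases "Kc U (str (a m + (i * ?D + u))) (str 0) < 8 * l m - c")
      case False
      have "NID U (str (a m + (i * ?D + u))) (str (b m + (?\<pi> i * ?D + v))) < 1/3"
      proof (rule NID_lt)
        \<comment> \<open>Since the matching is an involution, the same decoding works in both
          directions.\<close>
        have "?\<pi> (?\<pi> i) = i"
          using that(1) Jless[of m] m by (intro partner_partner) auto
        then show "Kc U (str (a m + (i * ?D + u))) (str (b m + (?\<pi> i * ?D + v))) \<le> m + l m + C1 + C2"
          using C1[OF that(2,3), of "?\<pi> i"] by simp
        show "Kc U (str (b m + (?\<pi> i * ?D + v))) (str (a m + (i * ?D + u))) \<le> m + l m + C1 + C2"
          using C2[OF that(3,2), of i] by simp
        show "8 * l m - c \<le> Kp U (str (a m + (i * ?D + u)))"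
          using False by (simp add: Kp_def)
        have "3 * (m + l m + C1 + C2) + c < 8 * l m"
          using m l8[of m] by (auto simp: distrib_left)
        then show "3 * (m + l m + C1 + C2) < 8 * l m - c"
          by (simp only: less_diff_conv)
      qed
      then show ?thesis using miss_Suc_le[of k] \<open>odd k\<close> by (simp add: trans_le_add1)
    qed (simp add: miss_def)
    \<comment> \<open>Each first component occurs once for every \<open>v\<close> in the partner
      block, whence the factor \<open>?D\<close>.\<close>
    have "(\<Sum>i<?R. \<Sum>u<?D. \<Sum>v<?D. ?simple (i * ?D + u)) = ?D * (\<Sum>p<?R * ?D. ?simple p)"
      unfolding sum_blocks by (simp add: sum_distrib_left del: sum_of_bool_eq)
    also have "\<dots> \<le> ?D * 2 ^ (8 * l m - c)"
      by (intro mult_left_mono count_simple_strings[OF U]) simp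
    finally have "2 ^ c * (\<Sum>i<?R. \<Sum>u<?D. \<Sum>v<?D. ?simple (i * ?D + u)) \<le> 2 ^ c * (?D * 2 ^ (8 * l m - c))"
      by simp
    also have "\<dots> = ?R * (?D * ?D)"
      using cM by (simp add: power_add[symmetric])
    finally have few: "2 ^ c * (\<Sum>i<?R. \<Sum>u<?D. \<Sum>v<?D. ?simple (i * ?D + u)) \<le> ?R * (?D * ?D)" .
    have "(\<Sum>i<?R. \<Sum>u<?D. \<Sum>v<?D. miss (Suc k) (a m + (i * ?D + u)) (b m + (?\<pi> i * ?D + v))) \<le>
        (\<Sum>i<?R. \<Sum>u<?D. \<Sum>v<?D. miss k (a m + (i * ?D + u)) (b m + (?\<pi> i * ?D + v)) +
          ?simple (i * ?D + u))"
      using point by (intro sum_mono) auto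
    also have "\<dots> = (\<Sum>i<?R. \<Sum>u<?D. \<Sum>v<?D. miss k (a m + (i * ?D + u)) (b m + (?\<pi> i * ?D + v))) +
        (\<Sum>i<?R. \<Sum>u<?D. \<Sum>v<?D. ?simple (i * ?D + u))"
      by (simp only: sum.distrib)
    finally have "2 ^ c * (\<Sum>i<?R. \<Sum>u<?D. \<Sum>v<?D.
          miss (Suc k) (a m + (i * ?D + u)) (b m + (?\<pi> i * ?D + v))) \<le>
        2 ^ c * ((\<Sum>i<?R. \<Sum>u<?D. \<Sum>v<?D. miss k (a m + (i * ?D + u)) (b m + (?\<pi> i * ?D + v))) +
          (\<Sum>i<?R. \<Sum>u<?D. \<Sum>v<?D. ?simple (i * ?D + u)))"
      by (rule mult_left_mono) simp
    with few show "2 ^ c * (\<Sum>i<?R. \<Sum>u<?D. \<Sum>v<?D.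
          miss (Suc k) (a m + (i * ?D + u)) (b m + (?\<pi> i * ?D + v))) \<le>
        2 ^ c * (\<Sum>i<?R. \<Sum>u<?D. \<Sum>v<?D. miss k (a m + (i * ?D + u)) (b m + (?\<pi> i * ?D + v))) +
          ?R * (?D * ?D)"
      unfolding distrib_left by linarith
  qed simp
qed

text \<open>One round passes a high and a low threshold. In units of \<open>2^-c\<close> each adds
  at most 1 to the failing fraction; averaging preserves this bound when a matching, and later a
  block, is selected.\<close>

lemma square_refine:
  assumes a: "comput (\<lambda>e. a (e 0))" and b: "comput (\<lambda>e. b (e 0))" and l: "comput (\<lambda>e. l (e 0))"
    and l8: "\<And>m. 8 * m \<le> l m" and k: "even k"
    and few: "\<And>m. m \<ge> m0 \<Longrightarrow>
      2 ^ c * (\<Sum>p<2 ^ (8 * l m). \<Sum>q<2 ^ (8 * l m). miss k (a m + p) (b m + q)) \<le>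
      K * (2 ^ (8 * l m) * 2 ^ (8 * l m))"
  shows "\<exists>a' b'. comput (\<lambda>e. a' (e 0)) \<and> comput (\<lambda>e. b' (e 0)) \<and> (\<exists>m1. \<forall>m\<ge>m1.
      2 ^ c * (\<Sum>p<2 ^ l m. \<Sum>q<2 ^ l m. miss (Suc (Suc k)) (a' m + p) (b' m + q)) \<le>
      (K + 2) * (2 ^ l m * 2 ^ l m))"
proof -
  \<comment> \<open>A side of length \<open>2 ^ (8 * l m)\<close> is cut into \<open>R m\<close>
    blocks of length \<open>D m\<close>.\<close>
  define R D where "R m = (2::nat) ^ (7 * l m)" and "D m = (2::nat) ^ l m" for m
  have RD: "2 ^ (8 * l m) = R m * D m" for m
    by (simp add: R_def D_def power_add[symmetric])
  have pos: "R m > 0" "D m > 0" for m by (simp_all add: R_def D_def)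
  have R: "comput (\<lambda>e. R (e 0))" and D: "comput (\<lambda>e. D (e 0))"
    unfolding R_def D_def by (intro comput_intros l)+
  note subst = comput_subst1[OF a] comput_subst1[OF b] comput_subst1[OF R] comput_subst1[OF D]
  define band where "band k' m j = (\<Sum>i<R m. \<Sum>u<D m. \<Sum>v<D m.
      miss k' (a m + (i * D m + u)) (b m + (partner (R m) j i * D m + v)))" for k' m j

  have "\<exists>m1. \<forall>m\<ge>m1.
    2 ^ c * (\<Sum>p<2 ^ (8 * l m). \<Sum>q<2 ^ (8 * l m). miss (Suc k) (a m + p) (b m + q)) \<le>
    2 ^ c * (\<Sum>p<2 ^ (8 * l m). \<Sum>q<2 ^ (8 * l m). miss k (a m + p) (b m + q)) +
      2 ^ (8 * l m) * 2 ^ (8 * l m)"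
  proof (rule square_step[OF a b _ _ k])
    show "comput (\<lambda>e. 8 * l (e 0))" by (intro comput_intros l)
    show "8 * m \<le> 8 * l m" for m using l8[of m] by linarith
  qed
  then obtain m1 where m1: "\<And>m. m \<ge> m1 \<Longrightarrow>
    2 ^ c * (\<Sum>p<R m * D m. \<Sum>q<R m * D m. miss (Suc k) (a m + p) (b m + q)) \<le>
    2 ^ c * (\<Sum>p<R m * D m. \<Sum>q<R m * D m. miss k (a m + p) (b m + q)) + R m * D m * (R m * D m)"
    unfolding RD by blast
  define m2 where "m2 = max m0 m1"
  have "\<exists>j<R m. 2 ^ c * band (Suc k) m j \<le> (K + 1) * (R m * (D m * D m))" if "m \<ge> m2" for m
  proof (rule sum_le_average)
    have "2 ^ c * (\<Sum>j<R m. band (Suc k) m j) =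
        2 ^ c * (\<Sum>p<R m * D m. \<Sum>q<R m * D m. miss (Suc k) (a m + p) (b m + q))"
      unfolding band_def sum_bands ..
    also have "\<dots> \<le> K * (R m * D m * (R m * D m)) + R m * D m * (R m * D m)"
      using m1[of m] few[of m] that unfolding RD m2_def by fastforce
    also have "\<dots> = R m * ((K + 1) * (R m * (D m * D m)))"
      by (simp add: algebra_simps)
    finally show "2 ^ c * (\<Sum>j<R m. band (Suc k) m j) \<le> R m * ((K + 1) * (R m * (D m * D m)))" .
  qed (rule pos)
  then have "\<exists>J. comput (\<lambda>e. J (e 0)) \<and> (\<forall>m\<ge>m2. J m < R m \<and>
      2 ^ c * band (Suc k) m (J m) \<le> (K + 1) * (R m * (D m * D m)))"
    unfolding band_def
    by (intro select_index) (unfold partner_def, (intro comput_intros subst pos)+)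
  then obtain J where J: "comput (\<lambda>e. J (e 0))" "\<And>m. m \<ge> m2 \<Longrightarrow> J m < R m"
    "\<And>m. m \<ge> m2 \<Longrightarrow> 2 ^ c * band (Suc k) m (J m) \<le> (K + 1) * (R m * (D m * D m))"
    by blast

  \<comment> \<open>The matching must be fixed before the low threshold is considered: the
    complexity bounds depend on a code for \<open>J\<close>.\<close>
  have "\<exists>m3\<ge>m2. \<forall>m\<ge>m3. 2 ^ c * band (Suc (Suc k)) m (J m) \<le>
      2 ^ c * band (Suc k) m (J m) + R m * (D m * D m)"
    unfolding band_def R_def D_def
    by (rule band_step[OF a b J(1) l l8]) (use k J(2) in \<open>auto simp: R_def\<close>)
  then obtain m3 where m3: "m3 \<ge> m2" "\<And>m. m \<ge> m3 \<Longrightarrow>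
      2 ^ c * band (Suc (Suc k)) m (J m) \<le> 2 ^ c * band (Suc k) m (J m) + R m * (D m * D m)"
    by blast
  define block where "block m i = (\<Sum>u<D m. \<Sum>v<D m. miss (Suc (Suc k)) (a m + (i * D m + u))
      (b m + (partner (R m) (J m) i * D m + v)))" for m i
  have "\<exists>i<R m. 2 ^ c * block m i \<le> (K + 2) * (D m * D m)" if "m \<ge> m3" for m
  proof (rule sum_le_average)
    have "2 ^ c * (\<Sum>i<R m. block m i) = 2 ^ c * band (Suc (Suc k)) m (J m)"
      unfolding band_def block_def ..
    also have "\<dots> \<le> (K + 1) * (R m * (D m * D m)) + R m * (D m * D m)"
      using m3(2)[OF that] J(3)[of m] that m3(1) by fastforce
    also have "\<dots> = R m * ((K + 2) * (D m * D m))"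
      by (simp add: algebra_simps)
    finally show "2 ^ c * (\<Sum>i<R m. block m i) \<le> R m * ((K + 2) * (D m * D m))" .
  qed (rule pos)
  \<comment> \<open>The one-term sum adapts the bound for a single block to the triple sum of
    \<open>select_index\<close>.\<close>
  then have ex: "\<exists>i<R m. 2 ^ c * (\<Sum>_<(1::nat). block m i) \<le> (K + 2) * (D m * D m)" if "m \<ge> m3" for m
    using that by simp
  have "\<exists>I. comput (\<lambda>e. I (e 0)) \<and> (\<forall>m\<ge>m3. I m < R m \<and>
      2 ^ c * (\<Sum>_<(1::nat). block m (I m)) \<le> (K + 2) * (D m * D m))"
    using ex unfolding block_def
    by (intro select_index[where A = "\<lambda>_. 1"])
      (unfold partner_def, (intro comput_intros subst pos comput_subst1[OF J(1)])+)
  then obtain I where I: "comput (\<lambda>e. I (e 0))"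
    "\<And>m. m \<ge> m3 \<Longrightarrow> 2 ^ c * block m (I m) \<le> (K + 2) * (D m * D m)"
    by auto
  show ?thesis
  proof (intro exI conjI allI impI)
    show "comput (\<lambda>e. a (e 0) + I (e 0) * D (e 0))"
      by (intro comput_intros subst comput_subst1[OF I(1)])
    show "comput (\<lambda>e. b (e 0) + partner (R (e 0)) (J (e 0)) (I (e 0)) * D (e 0))"
      unfolding partner_def
      by (intro comput_intros subst pos comput_subst1[OF I(1)] comput_subst1[OF J(1)])
    fix m assume "m \<ge> m3"
    then show "2 ^ c * (\<Sum>p<2 ^ l m. \<Sum>q<2 ^ l m. miss (Suc (Suc k)) (a m + I m * D m + p)
        (b m + partner (R m) (J m) (I m) * D m + q)) \<le> (K + 2) * (2 ^ l m * 2 ^ l m)"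
      using I(2)[of m] unfolding block_def D_def by (simp only: add.assoc)
  qed
qed

text \<open>Each round divides the exponent of the side by 8, so the induction keeps
  \<open>d\<close> arbitrary and starts its hypothesis one power higher. The exponent
  \<open>Suc d\<close> leaves sides of at least \<open>2 ^ (8 * m)\<close>, enough to pay for the
  unary code of \<open>m\<close>.\<close>

lemma oscillating_squares:
  "\<exists>a b. comput (\<lambda>e. a (e 0)) \<and> comput (\<lambda>e. b (e 0)) \<and> (\<exists>m0. \<forall>m\<ge>m0.
      2 ^ c * (\<Sum>p<2 ^ (8 ^ Suc d * m). \<Sum>q<2 ^ (8 ^ Suc d * m). miss (2 * k) (a m + p) (b m + q)) \<le>
      2 * k * (2 ^ (8 ^ Suc d * m) * 2 ^ (8 ^ Suc d * m)))"
proof (induction k arbitrary: d)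
  case 0
  show ?case
    by (intro exI[of _ "\<lambda>_. 0"] conjI comput_const) (simp add: miss_def)
next
  case (Suc k)
  obtain a b m0 where a: "comput (\<lambda>e. a (e 0))" and b: "comput (\<lambda>e. b (e 0))"
    and few: "\<And>m. m \<ge> m0 \<Longrightarrow> 2 ^ c * (\<Sum>p<2 ^ (8 * (8 ^ Suc d * m)). \<Sum>q<2 ^ (8 * (8 ^ Suc d * m)).
      miss (2 * k) (a m + p) (b m + q)) \<le> 2 * k * (2 ^ (8 * (8 ^ Suc d * m)) * 2 ^ (8 * (8 ^ Suc d * m)))"
    using Suc[of "Suc d"] unfolding power_Suc[of 8 "Suc d"] mult.assoc by blast
  have l: "comput (\<lambda>e. 8 ^ Suc d * e 0)" by (intro comput_intros)
  have l8: "8 * m \<le> 8 ^ Suc d * m" for m :: nat by (intro mult_right_mono) simp_all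
  have "even (2 * k)" by simp
  from square_refine[OF a b l l8 this few] show ?case
    by (simp only: mult_Suc_right add_2_eq_Suc add.commute[of _ 2])
qed

lemma unbounded_oscillation: "\<exists>x y. oscillates (f x y) True (2 * k)"
proof -
  obtain a b m where few: "2 ^ (2 * k) *
      (\<Sum>p<2 ^ (8 ^ Suc 0 * m). \<Sum>q<2 ^ (8 ^ Suc 0 * m). miss (2 * k) (a m + p) (b m + q)) \<le>
      2 * k * (2 ^ (8 ^ Suc 0 * m) * 2 ^ (8 ^ Suc 0 * m))"
    \<comment> \<open>Precision \<open>c = 2 * k\<close> suffices: if every pair failed,
      \<open>2 ^ (2 * k) <= 2 * k\<close> would follow.\<close>
    using oscillating_squares[of "2 * k" k 0] by (meson order_refl)
  define N :: nat where "N = 2 ^ (8 ^ Suc 0 * m)"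
  have "\<exists>x y s. osc (2 * k) x y s"
  proof (rule ccontr)
    assume "\<not> (\<exists>x y s. osc (2 * k) x y s)"
    then have "miss (2 * k) x y = 1" for x y by (simp add: miss_def)
    then have "2 ^ (2 * k) * (N * N) \<le> 2 * k * (N * N)"
      using few unfolding N_def[symmetric] by simp
    then have "2 ^ (2 * k) \<le> 2 * k" by (simp add: N_def)
    then show False using less_exp[of "2 * k"] by linarith
  qed
  \<comment> \<open>The nested stages of \<open>osc\<close> are unrolled into a nondecreasing
    sequence of times; beyond the last relevant position it stays constant.\<close>
  moreover have "\<exists>t. mono t \<and> (\<forall>i. t i \<le> s) \<and>
      (\<forall>i<n. if even i then 2/3 < f (str x) (str y) (t i) else f (str x) (str y) (t i) < 1/3)"
    if "osc n x y s" for n x y s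
    using that
  proof (induction n arbitrary: s)
    case 0
    show ?case by (intro exI[of _ "\<lambda>_. s"]) (simp add: mono_def)
  next
    case (Suc n)
    then obtain r where r: "r \<le> s" "osc n x y r"
      "if even n then 2/3 < f (str x) (str y) r else f (str x) (str y) r < 1/3" by auto
    obtain t where t: "mono t" "\<And>i. t i \<le> r"
      "\<And>i. i < n \<Longrightarrow> if even i then 2/3 < f (str x) (str y) (t i) else f (str x) (str y) (t i) < 1/3"
      using Suc.IH[OF r(2)] by blast
    show ?case
    proof (intro exI[of _ "\<lambda>i. if i < n then t i else r"] conjI allI impI)
      show "mono (\<lambda>i. if i < n then t i else r)"
        using t(1,2) by (auto simp: mono_def)
      show "(if i < n then t i else r) \<le> s" for i
        using r(1) t(2)[of i] by auto
      fix i assume "i < Suc n"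
      then consider "i < n" | "i = n" by linarith
      then show "if even i then 2/3 < f (str x) (str y) (if i < n then t i else r)
          else f (str x) (str y) (if i < n then t i else r) < 1/3"
      proof cases
        case 1
        then show ?thesis using t(3)[OF 1] by (simp only: if_True)
      next
        case 2
        then show ?thesis using r(3) by (simp only: less_irrefl if_False)
      qed
    qed
  qed
  ultimately obtain x y and t :: "nat \<Rightarrow> nat" where "mono t"
    "\<forall>i<2 * k. if even i then 2/3 < f (str x) (str y) (t i) else f (str x) (str y) (t i) < 1/3"
    by blast
  then have "oscillates (f (str x) (str y)) True (2 * k)"
    unfolding oscillates_def eq_True by blast
  then show ?thesis by blast
qed

end

theorem mainTheorem13:
  fixes U :: machine and n :: nat
  assumes "universal_pf_machine U"
    and "n \<ge> 1"
  shows "\<not> in_Sigma n (NID U) \<and> \<not> in_Pi n (NID U)"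
proof -
  have False if f: "approximates f (NID U)" and shape: "\<forall>x y. sig_shape n (f x y) \<or> pi_shape n (f x y)"
    for f
  proof -
    interpret NID_approximation U f using assms(1) f by unfold_locales
    \<comment> \<open>\<open>2 * Suc n\<close> alternations exceed the bound \<open>2 * n\<close>
      that either shape of level \<open>n\<close> allows.\<close>
    obtain x y where "oscillates (f x y) True (2 * Suc n)"
      using unbounded_oscillation by blast
    with shape_oscillation_bound[of n "f x y" True "2 * Suc n"] shape show False by simp
  qed
  then show ?thesis unfolding in_Sigma_def in_Pi_def by blast
qed

end
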